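(* Let $G$ be a locally compact abelian group and let $\mu\in\mathcal{M}^\infty(G)$ be a translation bounded measure. Then $\mu$ is a weakly almost periodic measure if and only if its hull $(\mathbb{X}(\mu),T)$ is a weakly almost periodic dynamical system.
   Context: $C_c(G)$ is the space of continuous compactly supported functions on $G$, and $C_u(G)$ the Banach space of bounded uniformly continuous complex functions on $G$ with the sup norm. A measure on $G$ is a (complex) Radon measure, i.e. a linear functional on $C_c(G)$ continuous in the inductive limit topology; the vague topology is the weak-* topology of this duality. A measure $\mu$ is translation bounded if $\sup_{x\in G}|\mu|(x+K)<\infty$ for every compact $K\subset G$, where $|\mu|$ is the variation measure; $\mathcal{M}^\infty(G)$ is the space of such measures. For $c\in C_c(G)$, $(c*\mu)(x)=\int_G c(x-t)\,d\mu(t)$. Translations are $T^tf(x)=f(x-t)$ for functions and $T^t\mu=\delta_t*\mu$ for measures. A function $f\in C_u(G)$ is weakly almost periodic if $\{T^tf: t\in G\}$ is precompact in the weak topology of the Banach space $C_u(G)$. A measure $\mu\in\mathcal{M}^\infty(G)$ is weakly almost periodic if $c*\mu$ is a weakly almost periodic function for every $c\in C_c(G)$. The hull of $\mu$ is $\mathbb{X}(\mu)=\overline{\{T^t\mu:t\in G\}}$ (closure in the vague topology); it is vaguely compact and $G$ acts continuously on it by $T$. A dynamical system $(\mathbb{X},T)$ (a compact space with a continuous $G$-action) is weakly almost periodic if for every $f\in C(\mathbb{X})$ the set $\{f\circ T^t:t\in G\}$ is relatively compact in the weak topology of $(C(\mathbb{X}),\|\cdot\|_\infty)$. *)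

theory Defs
  imports "HOL-Analysis.Analysis"
begin

section \<open>Function spaces\<close>

text \<open>Functions on a set \<open>S\<close> that is not a whole type are represented by extensional functions;
  for \<open>S = UNIV\<close> this is no restriction.\<close>

definition sup_norm :: "'b set \<Rightarrow> ('b \<Rightarrow> complex) \<Rightarrow> real" where
  "sup_norm S f = (SUP x\<in>S. cmod (f x))"

abbreviation supp :: "('a::topological_space \<Rightarrow> 'b::real_normed_vector) \<Rightarrow> 'a set" where
  "supp f \<equiv> closure (support_on UNIV f)"

definition Cc :: "('a::topological_space \<Rightarrow> 'b::real_normed_vector) set" where
  "Cc = {f. continuous_on UNIV f \<and> compact (supp f)}"

text \<open>Uniform continuity refers to the uniform structure that the group carries by virtue of its
  topology.\<close>

definition Cu :: "('a::topological_ab_group_add \<Rightarrow> complex) set" where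
  "Cu = {f. bounded (range f) \<and>
     (\<forall>e>0. \<exists>U. open U \<and> 0 \<in> U \<and> (\<forall>x y. x - y \<in> U \<longrightarrow> dist (f x) (f y) < e))}"

definition C_space :: "'b topology \<Rightarrow> ('b \<Rightarrow> complex) set" where
  "C_space X = {f \<in> extensional (topspace X). continuous_map X euclidean f}"

section \<open>Weak topology of a space of functions with the sup norm\<close>

text \<open>Here \<open>V\<close> is a linear space of bounded functions on \<open>S\<close>, normed by \<^term>\<open>sup_norm S\<close>.\<close>

definition bounded_functionals :: "'b set \<Rightarrow> ('b \<Rightarrow> complex) set \<Rightarrow> (('b \<Rightarrow> complex) \<Rightarrow> complex) set" where
  "bounded_functionals S V = {\<phi>.
     (\<forall>f\<in>V. \<forall>g\<in>V. \<forall>a b. \<phi> (\<lambda>x\<in>S. a * f x + b * g x) = a * \<phi> f + b * \<phi> g) \<and>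
     (\<exists>B. \<forall>f\<in>V. cmod (\<phi> f) \<le> B * sup_norm S f)}"

definition weak_topology :: "'b set \<Rightarrow> ('b \<Rightarrow> complex) set \<Rightarrow> ('b \<Rightarrow> complex) topology" where
  "weak_topology S V =
     pullback_topology V (\<lambda>f. \<lambda>\<phi>\<in>bounded_functionals S V. \<phi> f)
       (product_topology (\<lambda>_. euclidean) (bounded_functionals S V))"

definition relatively_compact_in :: "'b topology \<Rightarrow> 'b set \<Rightarrow> bool" where
  "relatively_compact_in X A \<longleftrightarrow> A \<subseteq> topspace X \<and> compactin X (X closure_of A)"

section \<open>Radon measures\<close>

text \<open>A base of neighbourhoods of 0 for the locally convex inductive limit topology on \<^const>\<open>Cc\<close>:
  the absolutely convex sets whose trace on the functions supported in \<open>K\<close> is a neighbourhood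
  of 0 for the sup norm, for every compact \<open>K\<close>.\<close>

definition inductive_nhds0 :: "('a::topological_space \<Rightarrow> complex) set set" where
  "inductive_nhds0 = {V. V \<subseteq> Cc \<and>
     (\<forall>f\<in>V. \<forall>g\<in>V. \<forall>a b. cmod a + cmod b \<le> 1 \<longrightarrow> (\<lambda>x. a * f x + b * g x) \<in> V) \<and>
     (\<forall>K. compact K \<longrightarrow> (\<exists>e>0. {f \<in> Cc. supp f \<subseteq> K \<and> sup_norm UNIV f < e} \<subseteq> V))}"

definition inductive_limit_topology :: "('a::topological_space \<Rightarrow> complex) topology" where
  "inductive_limit_topology = topology (\<lambda>U. U \<subseteq> Cc \<and>
     (\<forall>f\<in>U. \<exists>V\<in>inductive_nhds0. (\<lambda>g x. f x + g x) ` V \<subseteq> U))"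

lemma inductive_nhds0_Int:
  assumes "V \<in> inductive_nhds0" "W \<in> inductive_nhds0"
  shows "V \<inter> W \<in> inductive_nhds0"
  unfolding inductive_nhds0_def mem_Collect_eq
proof (intro conjI)
  show "V \<inter> W \<subseteq> Cc"
    using assms by (auto simp: inductive_nhds0_def)
  show "\<forall>f\<in>V \<inter> W. \<forall>g\<in>V \<inter> W. \<forall>a b. cmod a + cmod b \<le> 1 \<longrightarrow> (\<lambda>x. a * f x + b * g x) \<in> V \<inter> W"
    using assms by (auto simp: inductive_nhds0_def)
  show "\<forall>K. compact K \<longrightarrow> (\<exists>e>0. {f \<in> Cc. supp f \<subseteq> K \<and> sup_norm UNIV f < e} \<subseteq> V \<inter> W)"
  proof (intro allI impI)
    fix K :: "'a set" assume K: "compact K"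
    obtain d where d: "d > 0" "{f \<in> Cc. supp f \<subseteq> K \<and> sup_norm UNIV f < d} \<subseteq> V"
      using assms(1) K unfolding inductive_nhds0_def by blast
    obtain e where e: "e > 0" "{f \<in> Cc. supp f \<subseteq> K \<and> sup_norm UNIV f < e} \<subseteq> W"
      using assms(2) K unfolding inductive_nhds0_def by blast
    show "\<exists>e>0. {f \<in> Cc. supp f \<subseteq> K \<and> sup_norm UNIV f < e} \<subseteq> V \<inter> W"
      using d e by (intro exI[of _ "min d e"]) auto
  qed
qed

lemma openin_inductive_limit_topology:
  "openin inductive_limit_topology U \<longleftrightarrow>
     U \<subseteq> Cc \<and> (\<forall>f\<in>U. \<exists>V\<in>inductive_nhds0. (\<lambda>g x. f x + g x) ` V \<subseteq> U)"
proof -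
  have "istopology (\<lambda>U :: ('a \<Rightarrow> complex) set. U \<subseteq> Cc \<and>
          (\<forall>f\<in>U. \<exists>V\<in>inductive_nhds0. (\<lambda>g x. f x + g x) ` V \<subseteq> U))" (is "istopology ?P")
    unfolding istopology_def
  proof (rule conjI; intro allI impI)
    fix A B :: "('a \<Rightarrow> complex) set" assume A: "?P A" and B: "?P B"
    show "?P (A \<inter> B)"
    proof (intro conjI ballI)
      fix f assume "f \<in> A \<inter> B"
      then obtain V W where "V \<in> inductive_nhds0" "(\<lambda>g x. f x + g x) ` V \<subseteq> A"
        "W \<in> inductive_nhds0" "(\<lambda>g x. f x + g x) ` W \<subseteq> B"
        using A B by blast
      then show "\<exists>V\<in>inductive_nhds0. (\<lambda>g x. f x + g x) ` V \<subseteq> A \<inter> B"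
        by (intro bexI[of _ "V \<inter> W"] inductive_nhds0_Int) auto
    qed (use A in auto)
  next
    fix \<K> :: "('a \<Rightarrow> complex) set set" assume *: "\<forall>K\<in>\<K>. ?P K"
    show "?P (\<Union>\<K>)"
    proof (intro conjI ballI)
      fix f assume "f \<in> \<Union>\<K>"
      then obtain K where K: "K \<in> \<K>" "f \<in> K" by blast
      then obtain V where "V \<in> inductive_nhds0" "(\<lambda>g x. f x + g x) ` V \<subseteq> K"
        using * by blast
      with K show "\<exists>V\<in>inductive_nhds0. (\<lambda>g x. f x + g x) ` V \<subseteq> \<Union>\<K>"
        by (meson Union_upper subset_trans)
    qed (use * in auto)
  qed
  then show ?thesis
    by (simp add: inductive_limit_topology_def topology_inverse')
qed

text \<open>Functionals on \<^const>\<open>Cc\<close> are extensional, so that equality and the vague topology only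
  depend on their values on \<^const>\<open>Cc\<close>.\<close>

definition radon_measures :: "(('a::topological_space \<Rightarrow> complex) \<Rightarrow> complex) set" where
  "radon_measures = {\<mu> \<in> extensional Cc.
     (\<forall>f\<in>Cc. \<forall>g\<in>Cc. \<forall>a b. \<mu> (\<lambda>x. a * f x + b * g x) = a * \<mu> f + b * \<mu> g) \<and>
     continuous_map inductive_limit_topology euclidean \<mu>}"

definition vague_topology :: "(('a::topological_space \<Rightarrow> complex) \<Rightarrow> complex) topology" where
  "vague_topology = subtopology (product_topology (\<lambda>_. euclidean) Cc) radon_measures"

text \<open>The variation \<open>|\<mu>|\<close>: first as a positive functional,
  \<open>|\<mu>|(f) = sup {|\<mu>(g)| : g \<in> Cc, |g| \<le> f}\<close> for \<open>0 \<le> f \<in> Cc\<close>, then as the set function that the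
  Riesz representation theorem associates with this functional.\<close>

definition variation_functional ::
  "(('a::topological_space \<Rightarrow> complex) \<Rightarrow> complex) \<Rightarrow> ('a \<Rightarrow> real) \<Rightarrow> ennreal" where
  "variation_functional \<mu> f = (SUP g\<in>{g\<in>Cc. \<forall>x. cmod (g x) \<le> f x}. ennreal (cmod (\<mu> g)))"

definition variation :: "(('a::topological_space \<Rightarrow> complex) \<Rightarrow> complex) \<Rightarrow> 'a set \<Rightarrow> ennreal" where
  "variation \<mu> A = (INF U\<in>{U. open U \<and> A \<subseteq> U}.
     SUP f\<in>{f\<in>Cc. (\<forall>x. 0 \<le> f x \<and> f x \<le> 1) \<and> supp f \<subseteq> U}. variation_functional \<mu> f)"

definition translation_bounded_measures ::
  "(('a::topological_ab_group_add \<Rightarrow> complex) \<Rightarrow> complex) set" where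
  "translation_bounded_measures = {\<mu> \<in> radon_measures.
     \<forall>K. compact K \<longrightarrow> (SUP x. variation \<mu> ((+) x ` K)) < \<infinity>}"

section \<open>Translation and convolution\<close>

definition translate_fun :: "'a::topological_ab_group_add \<Rightarrow> ('a \<Rightarrow> complex) \<Rightarrow> 'a \<Rightarrow> complex" where
  "translate_fun t f = (\<lambda>x. f (x - t))"

text \<open>\<open>\<delta>\<^sub>t * \<mu>\<close>, that is \<open>f \<mapsto> \<integral>\<integral> f(s + x) d\<delta>\<^sub>t(s) d\<mu>(x)\<close>.\<close>

definition translate_measure :: "'a::topological_ab_group_add \<Rightarrow>
    (('a \<Rightarrow> complex) \<Rightarrow> complex) \<Rightarrow> (('a \<Rightarrow> complex) \<Rightarrow> complex)" where
  "translate_measure t \<mu> = (\<lambda>f\<in>Cc. \<mu> (\<lambda>x. f (t + x)))"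

definition conv :: "('a::topological_ab_group_add \<Rightarrow> complex) \<Rightarrow>
    (('a \<Rightarrow> complex) \<Rightarrow> complex) \<Rightarrow> 'a \<Rightarrow> complex" where
  "conv c \<mu> = (\<lambda>x. \<mu> (\<lambda>t. c (x - t)))"

section \<open>Weak almost periodicity\<close>

definition wap_function :: "('a::topological_ab_group_add \<Rightarrow> complex) \<Rightarrow> bool" where
  "wap_function f \<longleftrightarrow> f \<in> Cu \<and>
     relatively_compact_in (weak_topology UNIV Cu) (range (\<lambda>t. translate_fun t f))"

definition wap_measure :: "(('a::topological_ab_group_add \<Rightarrow> complex) \<Rightarrow> complex) \<Rightarrow> bool" where
  "wap_measure \<mu> \<longleftrightarrow> \<mu> \<in> translation_bounded_measures \<and> (\<forall>c\<in>Cc. wap_function (conv c \<mu>))"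

definition dynamical_system :: "'b topology \<Rightarrow> ('a::topological_ab_group_add \<Rightarrow> 'b \<Rightarrow> 'b) \<Rightarrow> bool" where
  "dynamical_system X T \<longleftrightarrow> compact_space X \<and>
     continuous_map (prod_topology euclidean X) X (\<lambda>(t, x). T t x) \<and>
     (\<forall>x\<in>topspace X. T 0 x = x) \<and>
     (\<forall>s t. \<forall>x\<in>topspace X. T (s + t) x = T s (T t x))"

definition wap_dynamical_system ::
  "'b topology \<Rightarrow> ('a::topological_ab_group_add \<Rightarrow> 'b \<Rightarrow> 'b) \<Rightarrow> bool" where
  "wap_dynamical_system X T \<longleftrightarrow> dynamical_system X T \<and>
     (\<forall>f\<in>C_space X. relatively_compact_in (weak_topology (topspace X) (C_space X))
        (range (\<lambda>t. \<lambda>x\<in>topspace X. f (T t x))))"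

definition hull_of :: "(('a::topological_ab_group_add \<Rightarrow> complex) \<Rightarrow> complex) \<Rightarrow>
    (('a \<Rightarrow> complex) \<Rightarrow> complex) topology" where
  "hull_of \<mu> = subtopology vague_topology
     (vague_topology closure_of (range (\<lambda>t. translate_measure t \<mu>)))"

end

theory Submission
  imports Defs
begin

text \<open>
  Write \<open>X\<close> for the hull. Evaluating \<open>f \<in> C(X)\<close> along the orbit of \<open>\<mu>\<close> gives a map \<open>C(X) \<rightarrow> C\<^sub>u(G)\<close>
  that is bounded, commutes with translations and sends the coordinate function of \<open>c \<in> C\<^sub>c(G)\<close> to
  \<open>c * \<mu>\<close>. It is therefore weakly continuous and carries relatively weakly compact orbits to such
  orbits, so a weakly almost periodic hull makes \<open>\<mu>\<close> weakly almost periodic.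

  Conversely, let every \<open>c * \<mu>\<close> be weakly almost periodic and let \<open>p\<close> be a pointwise limit of the maps
  \<open>T\<^sup>t\<close> on \<open>X\<close>. The value of a coordinate of \<open>p\<close> at \<open>\<omega>\<close> is the limit of one and the same function
  \<open>h \<in> C\<^sub>u(G)\<close>, a weak limit of translates of \<open>c * \<mu>\<close>, along any ultrafilter leading from the orbit of
  \<open>\<mu>\<close> to \<open>\<omega>\<close>; this forces the coordinate to be continuous. As the vague topology is initial for the
  coordinates, \<open>p\<close> is continuous, hence all pointwise limits \<open>f \<circ> p\<close> of the orbit of any \<open>f \<in> C(X)\<close> are
  continuous, and Grothendieck's criterion gives relative weak compactness. That criterion rests on
  the bounded convergence of functionals on \<open>C(X)\<close>, obtained here without a representation theorem.
\<close>

section \<open>Ultrafilters\<close>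

text \<open>Ultrafilters are proper filters deciding every predicate, so that \<open>tendsto\<close>
  and \<open>limitin\<close> apply to them directly; they play the part of universal
  subnets.\<close>

definition ultra :: "'b filter \<Rightarrow> bool" where
  "ultra U \<longleftrightarrow> U \<noteq> bot \<and> (\<forall>P. eventually P U \<or> eventually (\<lambda>x. \<not> P x) U)"

text \<open>Zorn's lemma for the reversed order on proper filters below \<open>F\<close>: the
  infimum of a nonempty chain is proper because the chain is a filter base. A minimal filter meets
  \<open>{x. P x}\<close> either trivially or in itself, and so decides \<open>P\<close>.\<close>

lemma ultra_le_ex:
  assumes "F \<noteq> bot"
  obtains U where "U \<le> F" "ultra U"
proof -
  let ?A = "{G. G \<le> F \<and> G \<noteq> bot}"
  have "\<exists>m\<in>?A. \<forall>a\<in>?A. m \<ge> a \<longrightarrow> a = m"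
  proof (rule predicate_Zorn)
    show "partial_order_on ?A (relation_of (\<ge>) ?A)"
      by (rule partial_order_on_relation_ofI) auto
  next
    fix C assume C: "C \<in> Chains (relation_of (\<ge>) ?A)"
    then have CA: "C \<subseteq> ?A" by (rule Chains_relation_of)
    have lin: "G \<le> H \<or> H \<le> G" if "G \<in> C" "H \<in> C" for G H
      using C that unfolding Chains_def relation_of_def by auto
    show "\<exists>u\<in>?A. \<forall>a\<in>C. a \<ge> u"
    proof (cases "C = {}")
      case True
      then show ?thesis using assms by auto
    next
      case False
      have "eventually P (Inf C) \<longleftrightarrow> (\<exists>b\<in>C. eventually P b)" for P
        using lin by (intro eventually_Inf_base False) (metis inf.absorb1 inf.absorb2 order_refl)
      then have "Inf C \<noteq> bot"
        using CA by (auto simp: trivial_limit_def)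
      moreover have "Inf C \<le> F"
        using False CA by (auto intro: Inf_lower2)
      ultimately show ?thesis by (auto intro: Inf_lower)
    qed
  qed
  then obtain U where U: "U \<le> F" "U \<noteq> bot"
    and min: "\<And>G. G \<le> F \<Longrightarrow> G \<noteq> bot \<Longrightarrow> G \<le> U \<Longrightarrow> G = U" by auto
  have "eventually P U \<or> eventually (\<lambda>x. \<not> P x) U" for P
  proof (cases "inf U (principal {x. P x}) = bot")
    case True
    then show ?thesis
      by (simp add: trivial_limit_def eventually_inf_principal)
  next
    case False
    then have "inf U (principal {x. P x}) = U"
      using U by (intro min) (auto intro: le_infI1)
    moreover have "eventually P (inf U (principal {x. P x}))"
      by (simp add: eventually_inf_principal)
    ultimately show ?thesis by simp
  qed
  with U that show thesis by (auto simp: ultra_def)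
qed

text \<open>Otherwise every point of \<open>K\<close> has a neighbourhood that \<open>f\<close>
  eventually avoids, since an ultrafilter decides membership; finitely many of them cover
  \<open>K\<close>.\<close>

lemma ultra_limitin_compactin:
  assumes U: "ultra U" and K: "compactin X K" and f: "eventually (\<lambda>x. f x \<in> K) U"
  obtains l where "l \<in> K" "limitin X f l U"
proof (rule ccontr)
  assume "\<not> thesis"
  then have no: "\<forall>l\<in>K. \<not> limitin X f l U" using that by blast
  have "\<exists>W. openin X W \<and> l \<in> W \<and> eventually (\<lambda>x. f x \<notin> W) U" if "l \<in> K" for l
  proof -
    have "l \<in> topspace X"
      using K that compactin_subset_topspace by blast
    with no that obtain W where "openin X W" "l \<in> W" "\<not> eventually (\<lambda>x. f x \<in> W) U"
      unfolding limitin_def by blast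
    with U show ?thesis unfolding ultra_def by blast
  qed
  then obtain W where W: "\<And>l. l \<in> K \<Longrightarrow> openin X (W l) \<and> l \<in> W l \<and> eventually (\<lambda>x. f x \<notin> W l) U"
    by metis
  then have "\<exists>\<F>. finite \<F> \<and> \<F> \<subseteq> W ` K \<and> K \<subseteq> \<Union>\<F>"
    by (intro compactinD[OF K]) auto
  then obtain D where D: "finite D" "D \<subseteq> K" "K \<subseteq> \<Union>(W ` D)"
    by (metis finite_subset_image)
  have "eventually (\<lambda>x. \<forall>l\<in>D. f x \<notin> W l) U"
    using D W by (intro eventually_ball_finite) auto
  with f have "eventually (\<lambda>x. False) U"
    by eventually_elim (use D in auto)
  with U show False by (simp add: ultra_def trivial_limit_def)
qed

lemma ultra_tendsto_bounded:
  fixes f :: "'b \<Rightarrow> 'c::euclidean_space"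
  assumes "ultra U" "\<And>x. norm (f x) \<le> B"
  obtains l where "(f \<longlongrightarrow> l) U"
  using ultra_limitin_compactin[OF assms(1), of euclidean "cball 0 B" f] assms(2)
  by (auto simp: mem_cball_0)

section \<open>Bounded convergence for functionals on continuous functions\<close>

text \<open>\<open>\<phi>\<close> acts on total functions that are continuous on \<open>X\<close>,
  so that algebraic operations need no restriction; by \<open>cong\<close> below, values outside
  \<open>topspace X\<close> do not matter.\<close>

locale sup_bounded_functional =
  fixes X :: "'b topology" and \<phi> :: "('b \<Rightarrow> complex) \<Rightarrow> complex" and B :: real
  assumes compact: "compact_space X"
    and linear: "continuous_map X euclidean f \<Longrightarrow> continuous_map X euclidean g \<Longrightarrow>
      \<phi> (\<lambda>x. a * f x + b * g x) = a * \<phi> f + b * \<phi> g"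
    and bound: "continuous_map X euclidean f \<Longrightarrow> (\<And>x. x \<in> topspace X \<Longrightarrow> cmod (f x) \<le> M) \<Longrightarrow>
      cmod (\<phi> f) \<le> B * M"
    and B_nonneg: "B \<ge> 0"
begin

definition dominated :: "('b \<Rightarrow> real) \<Rightarrow> ('b \<Rightarrow> complex) set" where
  "dominated v = {g. continuous_map X euclidean g \<and> (\<forall>x\<in>topspace X. cmod (g x) \<le> v x)}"

text \<open>The total variation of \<open>\<phi>\<close> evaluated at \<open>v \<ge> 0\<close>. It
  also makes sense for discontinuous \<open>v\<close>, such as the supremum of infinitely many
  continuous functions.\<close>

definition sup_dominated :: "('b \<Rightarrow> real) \<Rightarrow> real" where
  "sup_dominated v = (SUP g\<in>dominated v. cmod (\<phi> g))"

lemma linear_add: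
  "continuous_map X euclidean f \<Longrightarrow> continuous_map X euclidean g \<Longrightarrow> \<phi> (\<lambda>x. f x + g x) = \<phi> f + \<phi> g"
  using linear[of f g 1 1] by simp

lemma cong:
  assumes "continuous_map X euclidean f" "continuous_map X euclidean g"
    and "\<And>x. x \<in> topspace X \<Longrightarrow> f x = g x"
  shows "\<phi> f = \<phi> g"
proof -
  have "cmod (\<phi> (\<lambda>x. 1 * f x + (-1) * g x)) \<le> B * 0"
    using continuous_map_diff[OF assms(1,2)] assms(3) by (intro bound) simp_all
  then show ?thesis
    by (subst (asm) linear[OF assms(1,2)]) simp
qed

lemma zero_dominated: "(\<And>x. x \<in> topspace X \<Longrightarrow> 0 \<le> v x) \<Longrightarrow> (\<lambda>x. 0) \<in> dominated v"
  by (auto simp: dominated_def)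

lemma sup_dominated_ge:
  assumes "g \<in> dominated v" "\<And>x. x \<in> topspace X \<Longrightarrow> v x \<le> M"
  shows "cmod (\<phi> g) \<le> sup_dominated v"
  unfolding sup_dominated_def
proof (rule cSUP_upper[OF assms(1)])
  show "bdd_above ((\<lambda>g. cmod (\<phi> g)) ` dominated v)"
    using assms(2) by (intro bdd_aboveI[of _ "B * M"])
      (force simp: dominated_def intro!: bound intro: order_trans)
qed

lemma sup_dominated_le:
  assumes "\<And>x. x \<in> topspace X \<Longrightarrow> 0 \<le> v x" "\<And>g. g \<in> dominated v \<Longrightarrow> cmod (\<phi> g) \<le> c"
  shows "sup_dominated v \<le> c"
  unfolding sup_dominated_def by (rule cSUP_least) (use zero_dominated[of v] assms in auto)

lemma sup_dominated_approx:
  assumes "\<And>x. x \<in> topspace X \<Longrightarrow> 0 \<le> v x" "e > 0"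
  obtains g where "g \<in> dominated v" "sup_dominated v - e < cmod (\<phi> g)"
proof (rule ccontr)
  assume "\<not> thesis"
  with that have "cmod (\<phi> g) \<le> sup_dominated v - e" if "g \<in> dominated v" for g
    by (meson not_le that)
  then have "sup_dominated v \<le> sup_dominated v - e"
    by (intro sup_dominated_le assms)
  with \<open>e > 0\<close> show False by simp
qed

lemma sup_dominated_mono:
  assumes "\<And>x. x \<in> topspace X \<Longrightarrow> 0 \<le> v x" "\<And>x. x \<in> topspace X \<Longrightarrow> v x \<le> w x"
    "\<And>x. x \<in> topspace X \<Longrightarrow> w x \<le> M"
  shows "sup_dominated v \<le> sup_dominated w"
  by (rule sup_dominated_le[OF assms(1)], simp, rule sup_dominated_ge[OF _ assms(3)])
    (use assms(2) in \<open>force simp: dominated_def\<close>)+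

text \<open>Near-maximisers for \<open>v\<close> and \<open>w\<close> are rotated by unimodular
  factors so that their values under \<open>\<phi>\<close> are nonnegative reals and add up without
  cancellation.\<close>

lemma sup_dominated_superadditive:
  assumes "\<And>x. x \<in> topspace X \<Longrightarrow> 0 \<le> v x" "\<And>x. x \<in> topspace X \<Longrightarrow> 0 \<le> w x"
    and "\<And>x. x \<in> topspace X \<Longrightarrow> v x + w x \<le> M"
  shows "sup_dominated v + sup_dominated w \<le> sup_dominated (\<lambda>x. v x + w x)"
proof (rule field_le_epsilon)
  fix e :: real assume "e > 0"
  then have e: "e / 2 > 0" by simp
  obtain f where f: "f \<in> dominated v" "sup_dominated v - e / 2 < cmod (\<phi> f)"
    using sup_dominated_approx[of v, OF assms(1) e] by blast
  obtain g where g: "g \<in> dominated w" "sup_dominated w - e / 2 < cmod (\<phi> g)"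
    using sup_dominated_approx[of w, OF assms(2) e] by blast
  have "\<exists>a. cmod a = 1 \<and> a * z = cmod z" for z
    by (rule exI[of _ "if z = 0 then 1 else cmod z / z"]) (simp add: norm_divide)
  then obtain a b where a: "cmod a = 1" "a * \<phi> f = cmod (\<phi> f)"
    and b: "cmod b = 1" "b * \<phi> g = cmod (\<phi> g)" by metis
  let ?h = "\<lambda>x. a * f x + b * g x"
  have cont: "continuous_map X euclidean f" "continuous_map X euclidean g"
    using f g by (auto simp: dominated_def)
  then have "continuous_map X euclidean ?h"
    by (auto simp: continuous_map_atin intro!: tendsto_intros)
  moreover have "cmod (?h x) \<le> v x + w x" if "x \<in> topspace X" for x
    using f(1) g(1) that
    by (intro order_trans[OF norm_triangle_ineq] add_mono) (auto simp: dominated_def norm_mult a b)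
  ultimately have "cmod (\<phi> ?h) \<le> sup_dominated (\<lambda>x. v x + w x)"
    using assms(3) by (intro sup_dominated_ge) (auto simp: dominated_def)
  moreover have "cmod (\<phi> ?h) = cmod (\<phi> f) + cmod (\<phi> g)"
    using cont by (simp add: linear a b flip: of_real_add)
  ultimately show "sup_dominated v + sup_dominated w \<le> sup_dominated (\<lambda>x. v x + w x) + e"
    using f(2) g(2) by argo
qed

text \<open>Splitting \<open>g\<close> as \<open>g v / (v + w) + g w / (v + w)\<close> would divide by zero; the term
  \<open>\<delta>\<close> in the denominators avoids this at the cost of a remainder of norm at most \<open>\<delta>\<close>.\<close>
lemma sup_dominated_subadditive:
  assumes v: "continuous_map X euclidean v" "\<And>x. x \<in> topspace X \<Longrightarrow> 0 \<le> v x" "\<And>x. x \<in> topspace X \<Longrightarrow> v x \<le> M"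
    and w: "continuous_map X euclidean w" "\<And>x. x \<in> topspace X \<Longrightarrow> 0 \<le> w x" "\<And>x. x \<in> topspace X \<Longrightarrow> w x \<le> M"
  shows "sup_dominated (\<lambda>x. v x + w x) \<le> sup_dominated v + sup_dominated w"
proof (rule sup_dominated_le)
  fix g assume g: "g \<in> dominated (\<lambda>x. v x + w x)"
  then have gc: "continuous_map X euclidean g" by (simp add: dominated_def)
  have "cmod (\<phi> g) \<le> sup_dominated v + sup_dominated w + B * \<delta>" if \<delta>: "\<delta> > 0" for \<delta>
  proof -
    let ?q = "\<lambda>k x. g x * complex_of_real (k x / (v x + w x + \<delta>))"
    have pos: "v x + w x + \<delta> > 0" if "x \<in> topspace X" for x
      using v(2)[OF that] w(2)[OF that] \<delta> by simp
    have cont: "continuous_map X euclidean (?q k)" if "continuous_map X euclidean k" for k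
      using gc v(1) w(1) pos that unfolding continuous_map_atin limitin_canonical_iff
      by (intro ballI tendsto_intros) force+
    \<comment> \<open>Applied to \<open>v\<close>, \<open>w\<close> and the constant
      \<open>\<delta>\<close>, the three shares into which \<open>g\<close> is split.\<close>
    have dom: "?q k \<in> dominated k" 
      if k: "continuous_map X euclidean k" "\<And>x. x \<in> topspace X \<Longrightarrow> 0 \<le> k x" for k
    proof -
      have "cmod (?q k x) \<le> k x" if x: "x \<in> topspace X" for x
      proof -
        have "cmod (g x) * k x \<le> (v x + w x + \<delta>) * k x"
          using g x \<delta> k(2)[OF x] by (intro mult_right_mono) (force simp: dominated_def)+
        then show ?thesis
          using pos[OF x] k(2)[OF x]
          by (simp add: norm_mult field_simps del: of_real_divide of_real_add)
      qed
      with cont[OF k(1)] show ?thesis by (simp add: dominated_def)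
    qed
    have cd: "continuous_map X euclidean (\<lambda>x. \<delta>)" by simp
    have eq: "(\<lambda>x. (?q v x + ?q w x) + ?q (\<lambda>x. \<delta>) x) x = g x" if "x \<in> topspace X" for x
    proof -
      have "v x / (v x + w x + \<delta>) + w x / (v x + w x + \<delta>) + \<delta> / (v x + w x + \<delta>) = 1"
        using pos[OF that] by (simp flip: add_divide_distrib)
      then have "g x = g x * complex_of_real (v x / (v x + w x + \<delta>) + w x / (v x + w x + \<delta>) + \<delta> / (v x + w x + \<delta>))"
        by simp
      then show ?thesis by (simp only: of_real_add distrib_left)
    qed
    have cs: "continuous_map X euclidean (\<lambda>x. (?q v x + ?q w x))"
      using cont[OF v(1)] cont[OF w(1)] by (rule continuous_map_add)
    have cs3: "continuous_map X euclidean (\<lambda>x. (?q v x + ?q w x) + ?q (\<lambda>x. \<delta>) x)"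
      using cs cont[OF cd] by (rule continuous_map_add)
    have "\<phi> g = \<phi> (\<lambda>x. (?q v x + ?q w x) + ?q (\<lambda>x. \<delta>) x)"
      using eq by (intro cong gc cs3) simp
    also have "\<dots> = \<phi> (?q v) + \<phi> (?q w) + \<phi> (?q (\<lambda>x. \<delta>))"
      using linear_add[OF cs cont[OF cd]] linear_add[OF cont[OF v(1)] cont[OF w(1)]] by simp
    finally have "cmod (\<phi> g) \<le> cmod (\<phi> (?q v)) + cmod (\<phi> (?q w)) + cmod (\<phi> (?q (\<lambda>x. \<delta>)))"
      by (simp only:) (intro norm_triangle_mono order_refl)
    moreover have "cmod (\<phi> (?q v)) \<le> sup_dominated v"
      using dom[of v] v by (intro sup_dominated_ge) auto
    moreover have "cmod (\<phi> (?q w)) \<le> sup_dominated w"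
      using dom[of w] w by (intro sup_dominated_ge) auto
    moreover have "cmod (\<phi> (?q (\<lambda>x. \<delta>))) \<le> B * \<delta>"
      using dom[of "\<lambda>x. \<delta>"] \<delta> cont[OF cd] by (intro bound) (auto simp: dominated_def)
    ultimately show ?thesis by linarith
  qed
  then have lim: "\<forall>\<^sub>F \<delta> in at_right 0. cmod (\<phi> g) \<le> sup_dominated v + sup_dominated w + B * \<delta>"
    by (auto simp: eventually_at_filter)
  have "((\<lambda>\<delta>. sup_dominated v + sup_dominated w + B * \<delta>) \<longlongrightarrow> sup_dominated v + sup_dominated w + B * 0) (at_right 0)"
    by (intro tendsto_intros)
  from tendsto_lowerbound[OF this lim] show "cmod (\<phi> g) \<le> sup_dominated v + sup_dominated w" by simp
qed (use v w in auto)

lemma sup_dominated_sum_le: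
  assumes "finite I" "\<And>i. i \<in> I \<Longrightarrow> continuous_map X euclidean (v i)"
    "\<And>i x. i \<in> I \<Longrightarrow> x \<in> topspace X \<Longrightarrow> 0 \<le> v i x \<and> v i x \<le> M"
  shows "sup_dominated (\<lambda>x. \<Sum>i\<in>I. v i x) \<le> (\<Sum>i\<in>I. sup_dominated (v i))"
  using assms
proof (induction I rule: finite_induct)
  case empty
  have "cmod (\<phi> g) \<le> B * 0" if "g \<in> dominated (\<lambda>x. 0)" for g
    using that by (intro bound) (auto simp: dominated_def)
  then show ?case by (auto intro!: sup_dominated_le)
next
  case (insert i I)
  let ?K = "max M (card I * M)"
  have "sup_dominated (\<lambda>x. v i x + (\<Sum>j\<in>I. v j x)) \<le> sup_dominated (v i) + sup_dominated (\<lambda>x. \<Sum>j\<in>I. v j x)"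
  proof (rule sup_dominated_subadditive[where M = ?K])
    show "continuous_map X euclidean (\<lambda>x. \<Sum>j\<in>I. v j x)"
      using insert by (intro continuous_map_sum) auto
    show "(\<Sum>j\<in>I. v j x) \<le> ?K" if "x \<in> topspace X" for x
      using insert.prems(2) that by (intro order_trans[OF sum_bounded_above[of _ _ M]]) auto
    show "v i x \<le> ?K" if "x \<in> topspace X" for x
      using insert.prems(2)[of i x] that by auto
  qed (use insert.prems in \<open>auto intro!: sum_nonneg\<close>)
  with insert show ?case by (force intro: order_trans)
qed

text \<open>Following Lewin: if \<open>v n = sup {|g k| : k \<ge> n}\<close> and \<open>|u i| \<le> v i\<close> nearly attains
  \<^term>\<open>sup_dominated (v i)\<close>, then \<open>|g n|\<close> exceeds \<open>w n = min {|u i| : i \<le> n}\<close> by at most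
  \<open>\<Sum>i\<le>n. max |g n| |u i| - |u i|\<close>, whose \<^const>\<open>sup_dominated\<close> is small by superadditivity, and \<open>w n\<close> tends to 0
  uniformly by Dini's theorem.\<close>
theorem bounded_convergence:
  assumes g: "\<And>n. continuous_map X euclidean (g n)"
    and M: "\<And>n x. x \<in> topspace X \<Longrightarrow> cmod (g n x) \<le> M"
    and lim: "\<And>x. x \<in> topspace X \<Longrightarrow> (\<lambda>n. g n x) \<longlonglongrightarrow> 0"
  shows "(\<lambda>n. \<phi> (g n)) \<longlonglongrightarrow> 0"
proof -
  define v where "v = (\<lambda>n x. SUP k\<in>{n..}. cmod (g k x))"
  have v_ge: "cmod (g k x) \<le> v n x" if "x \<in> topspace X" "n \<le> k" for n k x
    unfolding v_def using that M by (intro cSUP_upper) (auto intro!: bdd_aboveI)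
  have v_le: "v n x \<le> c" if "\<And>k. n \<le> k \<Longrightarrow> cmod (g k x) \<le> c" for n x c
    unfolding v_def using that by (intro cSUP_least) auto
  have v_M: "v n x \<le> M" if "x \<in> topspace X" for n x
    using M[OF that] by (intro v_le)
  have v_nonneg: "0 \<le> v n x" if "x \<in> topspace X" for n x
    using v_ge[OF that order_refl[of n]] norm_ge_zero order_trans by blast
  have v_mono: "v n x \<le> v i x" if "x \<in> topspace X" "i \<le> n" for n i x
    using that by (intro v_le v_ge) auto
  have v_lim: "eventually (\<lambda>n. v n x < e) sequentially" if x: "x \<in> topspace X" and "e > 0" for x e
  proof -
    have "eventually (\<lambda>n. cmod (g n x) < e / 2) sequentially"
      using tendstoD[OF lim[OF x], of "e / 2"] \<open>e > 0\<close> by simp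
    then obtain n0 where "\<And>n. n \<ge> n0 \<Longrightarrow> cmod (g n x) < e / 2"
      by (auto simp: eventually_sequentially)
    then have "v n x \<le> e / 2" if "n \<ge> n0" for n
      using that by (intro v_le) (meson less_imp_le order_trans)
    with \<open>e > 0\<close> show ?thesis
      unfolding eventually_sequentially by (intro exI[of _ n0]) force
  qed
  have "eventually (\<lambda>n. cmod (\<phi> (g n)) < e) sequentially" if "e > 0" for e
  proof -
    \<comment> \<open>The \<open>+ 1\<close> allows for \<open>B = 0\<close> and gives
      \<open>B * d < e / 2\<close>; the other half of \<open>e\<close> pays for the tolerances
      \<open>(e / 4) * (1 / 2) ^ i\<close>.\<close>
    define d where "d = e / (2 * (B + 1))"
    have d: "d > 0" "B * d < e / 2"
      using \<open>e > 0\<close> B_nonneg by (auto simp: d_def field_simps)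
    have "\<exists>u\<in>dominated (v i). sup_dominated (v i) - (e / 4) * (1 / 2) ^ i < cmod (\<phi> u)" for i
      using sup_dominated_approx[of "v i" "(e / 4) * (1 / 2) ^ i"] v_nonneg \<open>e > 0\<close> by (metis zero_less_divide_1_iff
        zero_less_divide_iff zero_less_mult_iff zero_less_numeral zero_less_power)
    then obtain u where u: "\<And>i. u i \<in> dominated (v i)"
      and N_u: "\<And>i. sup_dominated (v i) - (e / 4) * (1 / 2) ^ i < cmod (\<phi> (u i))" by metis
    define r where "r = (\<lambda>i x. cmod (u i x))"
    have r_cont: "continuous_map X euclidean (r i)" for i
      using u[of i] unfolding r_def dominated_def by (auto intro: continuous_map_norm)
    have r_le: "0 \<le> r i x \<and> r i x \<le> v i x" if "x \<in> topspace X" for i x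
      using u[of i] that by (auto simp: r_def dominated_def)
    define w where "w = (\<lambda>n x. Min ((\<lambda>i. r i x) ` {..n}))"
    have w_Suc: "w (Suc n) x = min (r (Suc n) x) (w n x)" for n x
      by (simp add: w_def atMost_Suc)
    have w_cont: "continuous_map X euclidean (w n)" for n
    proof (induction n)
      case 0
      then show ?case using r_cont[of 0] by (simp add: w_def)
    next
      case (Suc n)
      then show ?case unfolding w_Suc by (intro continuous_map_real_min r_cont)
    qed
    have w_le: "w n x \<le> r i x" if "i \<le> n" for n i x
      using that by (auto simp: w_def)
    have w_attained: "\<exists>i\<le>n. w n x = r i x" for n x
      using Min_in[of "(\<lambda>i. r i x) ` {..n}"] unfolding w_def by fastforce
    have w_anti: "w n x \<le> w i x" if "i \<le> n" for n i x
      using w_attained[of i x] w_le[of _ n x] that by (metis order_trans)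
    have w_nonneg: "0 \<le> w n x" if "x \<in> topspace X" for n x
      using w_attained[of n x] r_le[OF that] by metis
    \<comment> \<open>Dini's argument: the \<open>w n\<close> are continuous and decreasing in
      \<open>n\<close>, and \<open>w n \<le> v n\<close> tends to 0 pointwise, so finitely many of
      the open sets \<open>w n < d\<close> cover \<open>X\<close>.\<close>
    have "\<exists>n0. \<forall>n\<ge>n0. \<forall>x\<in>topspace X. w n x < d"
    proof -
      let ?O = "\<lambda>n. {x \<in> topspace X. w n x \<in> {..<d}}"
      have O: "openin X (?O n)" for n
        by (rule openin_continuous_map_preimage[OF w_cont]) auto
      have cov: "topspace X \<subseteq> \<Union>(range ?O)"
      proof
        fix x assume x: "x \<in> topspace X"
        obtain n where "v n x < d"
          using v_lim[OF x d(1)] by (auto simp: eventually_sequentially)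
        then have "x \<in> ?O n"
          using x r_le[OF x, of n] w_le[of n n x] by auto
        then show "x \<in> \<Union>(range ?O)" by blast
      qed
      have "\<exists>\<F>. finite \<F> \<and> \<F> \<subseteq> range ?O \<and> topspace X \<subseteq> \<Union>\<F>"
        using compact O cov unfolding compact_space_def by (intro compactinD) auto
      then obtain \<F> where \<F>: "finite \<F>" "\<F> \<subseteq> range ?O" "topspace X \<subseteq> \<Union>\<F>" by blast
      from finite_subset_image[OF \<F>(1,2)] obtain D where "finite D" "\<F> = ?O ` D" by blast
      with \<F>(3) have D: "finite D" "topspace X \<subseteq> (\<Union>n\<in>D. ?O n)" by simp_all
      show ?thesis
      proof (intro exI[of _ "Max (insert 0 D)"] allI impI ballI)
        fix n x assume n: "Max (insert 0 D) \<le> n" and "x \<in> topspace X"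
        then obtain i where i: "i \<in> D" "w i x < d" using D by blast
        then have "i \<le> n" using n D(1) by simp
        with i w_anti[of i n x] show "w n x < d" by simp
      qed
    qed
    then obtain n0 where n0: "\<And>n x. n \<ge> n0 \<Longrightarrow> x \<in> topspace X \<Longrightarrow> w n x < d" by blast
    have "cmod (\<phi> (g n)) < e" if n: "n \<ge> n0" for n
    proof -
      define q where "q = (\<lambda>i x. max (cmod (g n x)) (r i x) - r i x)"
      have q_cont: "continuous_map X euclidean (q i)" for i
        unfolding q_def
        by (intro continuous_map_diff continuous_map_real_max continuous_map_norm g r_cont)
      have q_bd: "0 \<le> q i x \<and> q i x \<le> M" if "x \<in> topspace X" for i x
        using M[OF that, of n] r_le[OF that, of i] v_M[OF that, of i] by (auto simp: q_def)
      \<comment> \<open>On \<open>X\<close>, \<open>r i + q i\<close> is the maximum of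
        \<open>|g n|\<close> and \<open>r i\<close>, still at most \<open>v i\<close> because
        \<open>i \<le> n\<close>. Superadditivity leaves for \<open>q i\<close> only the gap by
        which \<open>u i\<close> misses the supremum for \<open>v i\<close>.\<close>
      have N_q: "sup_dominated (q i) \<le> (e / 4) * (1 / 2) ^ i" if i: "i \<le> n" for i
      proof -
        have "sup_dominated (r i) + sup_dominated (q i) \<le> sup_dominated (\<lambda>x. r i x + q i x)"
        proof (rule sup_dominated_superadditive)
          show "r i x + q i x \<le> M" if "x \<in> topspace X" for x
            using M[OF that, of n] r_le[OF that, of i] v_M[OF that, of i] by (auto simp: q_def)
        qed (use r_le q_bd in auto)
        also have "\<dots> \<le> sup_dominated (v i)"
        proof (rule sup_dominated_mono)
          show "r i x + q i x \<le> v i x" if "x \<in> topspace X" for x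
            using r_le[OF that, of i] v_ge[OF that i] by (auto simp: q_def)
        qed (use r_le q_bd v_M in \<open>auto intro!: add_nonneg_nonneg\<close>)
        finally have "sup_dominated (r i) + sup_dominated (q i) \<le> sup_dominated (v i)" .
        moreover have "cmod (\<phi> (u i)) \<le> sup_dominated (r i)"
          using u[of i] r_le[of _ i] v_M[of _ i] unfolding r_def
          by (intro sup_dominated_ge[of _ _ M]) (auto simp: dominated_def intro: order_trans)
        ultimately show ?thesis using N_u[of i] by linarith
      qed
      have "cmod (\<phi> (g n)) \<le> sup_dominated (\<lambda>x. w n x + (\<Sum>i\<le>n. q i x))"
      proof (rule sup_dominated_ge)
        show "g n \<in> dominated (\<lambda>x. w n x + (\<Sum>i\<le>n. q i x))"
          unfolding dominated_def
        proof (intro CollectI conjI ballI g)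
          fix x assume x: "x \<in> topspace X"
          obtain i where i: "i \<le> n" "w n x = r i x" using w_attained by blast
          have "cmod (g n x) \<le> w n x + q i x" using i by (simp add: q_def)
          also have "q i x \<le> (\<Sum>i\<le>n. q i x)"
            using i(1) q_bd[OF x] by (intro member_le_sum) auto
          finally show "cmod (g n x) \<le> w n x + (\<Sum>i\<le>n. q i x)" by simp
        qed
        show "w n x + (\<Sum>i\<le>n. q i x) \<le> d + (Suc n) * M" if "x \<in> topspace X" for x
          using n0[OF n that] sum_bounded_above[of "{..n}" "\<lambda>i. q i x" M] q_bd[OF that] by simp
      qed
      also have "\<dots> \<le> sup_dominated (w n) + sup_dominated (\<lambda>x. \<Sum>i\<le>n. q i x)"
      proof (rule sup_dominated_subadditive)
        show "continuous_map X euclidean (\<lambda>x. \<Sum>i\<le>n. q i x)"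
          by (intro continuous_map_sum q_cont) auto
        show "w n x \<le> max d ((Suc n) * M)" if "x \<in> topspace X" for x
          using n0[OF n that] by simp
        show "(\<Sum>i\<le>n. q i x) \<le> max d ((Suc n) * M)" if "x \<in> topspace X" for x
          using sum_bounded_above[of "{..n}" "\<lambda>i. q i x" M] q_bd[OF that] by simp
      qed (use w_cont w_nonneg q_bd in \<open>auto intro!: sum_nonneg\<close>)
      also have "sup_dominated (\<lambda>x. \<Sum>i\<le>n. q i x) \<le> (\<Sum>i\<le>n. sup_dominated (q i))"
        using q_cont q_bd by (intro sup_dominated_sum_le[where M = M]) auto
      also have "\<dots> \<le> (\<Sum>i\<le>n. (e / 4) * (1 / 2) ^ i)"
        using N_q by (intro sum_mono) auto
      also have "\<dots> = (e / 4) * (\<Sum>i\<le>n. (1 / 2) ^ i)"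
        by (simp add: sum_distrib_left)
      also have "(\<Sum>i\<le>n. (1 / 2 :: real) ^ i) \<le> 2"
      proof -
        have "(\<Sum>i\<le>n. (1 / 2 :: real) ^ i) = 2 - (1 / 2) ^ n"
          by (induction n) simp_all
        then show ?thesis by simp
      qed
      also have "sup_dominated (w n) \<le> B * d"
        using n0[OF n] w_nonneg
        by (intro sup_dominated_le bound) (fastforce simp: dominated_def)+
      finally show ?thesis using d \<open>e > 0\<close> by (simp add: mult_left_mono)
    qed
    then show ?thesis by (auto simp: eventually_sequentially)
  qed
  then show ?thesis by (intro tendstoI) (simp add: dist_norm)
qed

end

section \<open>Grothendieck's criterion for weak compactness\<close>

text \<open>\<open>F\<close> lies in the closure of \<open>A\<close> for pointwise convergence on
  \<open>S\<close>, spelled out with finite test sets.\<close>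

definition pointwise_limit :: "'b set \<Rightarrow> ('b \<Rightarrow> complex) set \<Rightarrow> ('b \<Rightarrow> complex) \<Rightarrow> bool" where
  "pointwise_limit S A F \<longleftrightarrow>
     (\<forall>T e. finite T \<longrightarrow> T \<subseteq> S \<longrightarrow> e > 0 \<longrightarrow> (\<exists>g\<in>A. \<forall>x\<in>T. cmod (g x - F x) < e))"

lemma pointwise_limit_mono: "pointwise_limit S A F \<Longrightarrow> A \<subseteq> B \<Longrightarrow> pointwise_limit S B F"
  unfolding pointwise_limit_def by (meson subsetD)

lemma pointwise_limit_ultra:
  assumes "ultra U" "eventually (\<lambda>n. g n \<in> A) U" "\<And>x. x \<in> S \<Longrightarrow> ((\<lambda>n. g n x) \<longlongrightarrow> F x) U"
  shows "pointwise_limit S A F"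
  unfolding pointwise_limit_def
proof (intro allI impI)
  fix T and e :: real assume T: "finite T" "T \<subseteq> S" "e > 0"
  have "eventually (\<lambda>n. \<forall>x\<in>T. cmod (g n x - F x) < e) U"
    using T assms(3) by (intro eventually_ball_finite) (auto simp: tendsto_iff dist_norm)
  with assms(2) have "eventually (\<lambda>n. g n \<in> A \<and> (\<forall>x\<in>T. cmod (g n x - F x) < e)) U"
    by (rule eventually_conj)
  then show "\<exists>g\<in>A. \<forall>x\<in>T. cmod (g x - F x) < e"
    using assms(1) eventually_happens'[of U] unfolding ultra_def by blast
qed

text \<open>Compactness for the pseudometric \<open>\<Sum>g\<in>H. |g s - g x|\<close>: its balls of
  radius \<open>e\<close> are open, and finitely many of them cover \<open>X\<close>.\<close>

lemma finite_net:
  fixes H :: "('b \<Rightarrow> complex) set"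
  assumes X: "compact_space X" and H: "finite H" "\<And>g. g \<in> H \<Longrightarrow> continuous_map X euclidean g"
    and "e > 0"
  obtains T where "finite T" "T \<subseteq> topspace X"
    "\<And>x. x \<in> topspace X \<Longrightarrow> \<exists>s\<in>T. \<forall>g\<in>H. cmod (g s - g x) < e"
proof -
  let ?d = "\<lambda>x s. \<Sum>g\<in>H. cmod (g s - g x)"
  let ?O = "\<lambda>s. {x \<in> topspace X. ?d s x \<in> {..<e}}"
  have "openin X (?O s)" for s
    using H by (intro openin_continuous_map_preimage[where Y = euclidean] continuous_map_sum
        continuous_map_norm continuous_map_diff) auto
  then have "\<exists>\<F>. finite \<F> \<and> \<F> \<subseteq> ?O ` topspace X \<and> topspace X \<subseteq> \<Union>\<F>"
    using X \<open>e > 0\<close> unfolding compact_space_def by (intro compactinD) auto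
  then obtain \<F> where \<F>: "finite \<F>" "\<F> \<subseteq> ?O ` topspace X" "topspace X \<subseteq> \<Union>\<F>" by blast
  from finite_subset_image[OF \<F>(1,2)] obtain T where T: "T \<subseteq> topspace X" "finite T" "\<F> = ?O ` T" by blast
  show thesis
  proof (rule that[OF T(2,1)])
    fix x assume "x \<in> topspace X"
    then obtain s where s: "s \<in> T" "?d s x < e" using \<F>(3) T(3) by auto
    have "cmod (g s - g x) < e" if "g \<in> H" for g
    proof -
      have "cmod (g x - g s) \<le> ?d s x"
        using that H(1) by (intro member_le_sum) auto
      with s(2) show ?thesis by (simp add: norm_minus_commute)
    qed
    with s(1) show "\<exists>s\<in>T. \<forall>g\<in>H. cmod (g s - g x) < e" by blast
  qed
qed

context sup_bounded_functional
begin

text \<open>A sequence in \<open>A\<close> converging pointwise to \<open>F\<close> is built together with increasing finite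
  sets \<open>T n\<close> that are \<open>1/n\<close>-dense for the functions chosen so far, \<open>g n\<close> being close to \<open>F\<close> on
  \<open>T n\<close>. A cluster point of the sequence then agrees with \<open>F\<close> on \<open>\<Union>n. T n\<close>, and, being
  continuous, everywhere.\<close>
lemma pointwise_limit_approx:
  assumes A: "\<And>g. g \<in> A \<Longrightarrow> continuous_map X euclidean g"
    and M: "\<And>g x. g \<in> A \<Longrightarrow> x \<in> topspace X \<Longrightarrow> cmod (g x) \<le> M"
    and cont: "\<And>F. pointwise_limit (topspace X) A F \<Longrightarrow> continuous_map X euclidean F"
    and F: "pointwise_limit (topspace X) A F"
    and "e > 0"
  shows "\<exists>g\<in>A. cmod (\<phi> g - \<phi> F) < e"
proof -
  note Fc = cont[OF F]
  \<comment> \<open>A state holds the latest function, the set \<open>H\<close> of \<open>F\<close>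
    and the functions chosen so far, and the finite set \<open>T\<close> of test points.\<close>
  let ?P = "\<lambda>(n::nat) (g::'b \<Rightarrow> complex, H, T). F \<in> H \<and> finite H \<and> (\<forall>k\<in>H. continuous_map X euclidean k) \<and>
     finite T \<and> T \<subseteq> topspace X"
  let ?Q = "\<lambda>n (g, H, T) (g', H', T'). H' = insert g' H \<and> T \<subseteq> T' \<and> g' \<in> A \<and>
     (\<forall>x\<in>topspace X. \<exists>s\<in>T'. \<forall>k\<in>H. cmod (k s - k x) < inverse (Suc n)) \<and>
     (\<forall>x\<in>T'. cmod (g' x - F x) < inverse (Suc n))"
  have "\<exists>st. \<forall>n. ?P n (st n) \<and> ?Q n (st n) (st (Suc n))"
  proof (rule dependent_nat_choice)
    show "\<exists>st. ?P 0 st" by (rule exI[of _ "(F, {F}, {})"]) (simp add: Fc)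
  next
    fix st and n :: nat assume st: "?P n st"
    obtain g H T where [simp]: "st = (g, H, T)" by (cases st)
    have n: "inverse (real (Suc n)) > 0" by simp
    obtain T' where T': "finite T'" "T' \<subseteq> topspace X"
      "\<And>x. x \<in> topspace X \<Longrightarrow> \<exists>s\<in>T'. \<forall>k\<in>H. cmod (k s - k x) < inverse (Suc n)"
      using finite_net[OF compact, of H "inverse (real (Suc n))"] st n by auto
    obtain g' where "g' \<in> A" "\<forall>x\<in>T \<union> T'. cmod (g' x - F x) < inverse (Suc n)"
      using F[unfolded pointwise_limit_def, rule_format, of "T \<union> T'", OF _ _ n] st T' by auto
    moreover have "\<exists>s\<in>T \<union> T'. \<forall>k\<in>H. cmod (k s - k x) < inverse (Suc n)"
      if "x \<in> topspace X" for x
      using T'(3)[OF that] by blast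
    ultimately have "?P (Suc n) (g', insert g' H, T \<union> T') \<and> ?Q n st (g', insert g' H, T \<union> T')"
      using st T'(1,2) A by (simp del: of_nat_Suc)
    then show "\<exists>st'. ?P (Suc n) st' \<and> ?Q n st st'" by (rule exI)
  qed
  then obtain st where "\<forall>n. ?P n (st n) \<and> ?Q n (st n) (st (Suc n))" by (rule exE)
  note st = this[THEN spec, THEN conjunct1] this[THEN spec, THEN conjunct2]
  \<comment> \<open>The first component of \<open>st 0\<close> need not lie in \<open>A\<close>, so
    the sequence starts with that of \<open>st 1\<close>.\<close>
  define G where "G = (\<lambda>n. fst (st (Suc n)))"
  define H where "H = (\<lambda>n. fst (snd (st n)))"
  define T where "T = (\<lambda>n. snd (snd (st n)))"
  have P: "F \<in> H n" "T n \<subseteq> topspace X" for n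
    using st(1)[of n] by (auto simp: H_def T_def split: prod.splits)
  have Q: "H (Suc n) = insert (G n) (H n)" "T n \<subseteq> T (Suc n)" "G n \<in> A"
    "x \<in> topspace X \<Longrightarrow> \<exists>s\<in>T (Suc n). \<forall>k\<in>H n. cmod (k s - k x) < inverse (Suc n)"
    "x \<in> T (Suc n) \<Longrightarrow> cmod (G n x - F x) < inverse (Suc n)" for n x
    using st(2)[of n] by (auto simp: G_def H_def T_def split: prod.splits)
  have T_mono: "T m \<subseteq> T n" if "m \<le> n" for m n
    using Q(2) that by (rule lift_Suc_mono_le)
  have H_mono: "H m \<subseteq> H n" if "m \<le> n" for m n
    using _ that by (rule lift_Suc_mono_le) (use Q(1) in blast)
  have G_H: "G i \<in> H n" if "i < n" for i n
    using H_mono[of "Suc i" n] Q(1)[of i] that by auto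
  have G_cont: "continuous_map X euclidean (G n)" for n
    using A Q(3) by blast
  have small: "(\<lambda>n. inverse (real (Suc n))) \<longlonglongrightarrow> 0"
    by (rule LIMSEQ_inverse_real_of_nat)
  have lim_T: "(\<lambda>n. G n s) \<longlonglongrightarrow> F s" if "s \<in> T m" for s m
  proof -
    have "eventually (\<lambda>n. cmod (G n s - F s) \<le> inverse (real (Suc n))) sequentially"
      unfolding eventually_sequentially
      using Q(5) T_mono that by (metis le_Suc_eq less_imp_le nat_le_linear subsetD)
    then have "(\<lambda>n. G n s - F s) \<longlonglongrightarrow> 0"
      by (rule Lim_null_comparison[OF _ small])
    then show ?thesis by (rule LIM_zero_cancel)
  qed
  have lim: "(\<lambda>n. G n x) \<longlonglongrightarrow> F x" if x: "x \<in> topspace X" for x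
  proof (rule ccontr)
    assume "\<not> ?thesis"
    then obtain d where d: "d > 0" "\<not> eventually (\<lambda>n. dist (G n x) (F x) < d) sequentially"
      unfolding tendsto_iff by blast
    then have "inf sequentially (principal {n. d \<le> cmod (G n x - F x)}) \<noteq> bot"
      by (simp add: trivial_limit_def eventually_inf_principal dist_norm not_le)
    \<comment> \<open>An ultrafilter living on the bad indices yields a pointwise cluster function
      \<open>h\<close> with \<open>h x \<noteq> F x\<close>.\<close>
    then obtain U where U: "U \<le> inf sequentially (principal {n. d \<le> cmod (G n x - F x)})" "ultra U"
      by (rule ultra_le_ex)
    have Useq: "U \<le> sequentially" using U(1) by simp
    have "\<forall>z\<in>topspace X. \<exists>l. ((\<lambda>n. G n z) \<longlongrightarrow> l) U"
      using ultra_tendsto_bounded[OF U(2)] M Q(3) by meson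
    from bchoice[OF this]
    obtain h where h: "\<And>z. z \<in> topspace X \<Longrightarrow> ((\<lambda>n. G n z) \<longlongrightarrow> h z) U" by blast
    have Unb: "U \<noteq> bot" using U(2) by (simp add: ultra_def)
    have hc: "continuous_map X euclidean h"
      by (intro cont pointwise_limit_ultra[OF U(2) _ h]) (auto simp: Q(3))
    have h_T: "h s = F s" if "s \<in> T m" for s m
      using tendsto_unique[OF Unb h tendsto_mono[OF Useq lim_T]] P(2) that by blast
    have "eventually (\<lambda>n. d \<le> cmod (G n x - F x)) U"
      using U(1) by (auto simp: le_inf_iff le_principal)
    moreover have "((\<lambda>n. cmod (G n x - F x)) \<longlongrightarrow> cmod (h x - F x)) U"
      using h[OF x] by (intro tendsto_intros)
    ultimately have far: "d \<le> cmod (h x - F x)"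
      using tendsto_lowerbound Unb by blast
    obtain s where s: "\<And>n. s n \<in> T (Suc n)"
      "\<And>n k. k \<in> H n \<Longrightarrow> cmod (k (s n) - k x) < inverse (Suc n)"
      using Q(4)[OF x] by metis
    obtain y where y: "y \<in> topspace X" "limitin X s y U"
      using ultra_limitin_compactin[OF U(2), of X "topspace X" s] compact s(1) P(2)
      unfolding compact_space_def by (metis always_eventually subsetD)
    have lim_s: "((\<lambda>n. k (s n)) \<longlongrightarrow> k y) U" if "continuous_map X euclidean k" for k :: "'b \<Rightarrow> complex"
      using continuous_map_limit[OF that y(2)] by (simp add: o_def)
    \<comment> \<open>The values of a function in \<open>H m\<close> at \<open>s n\<close> tend to
      its value at \<open>x\<close>, while \<open>s n\<close> converges to \<open>y\<close> along
      \<open>U\<close>; so no such function separates \<open>y\<close> from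
      \<open>x\<close>.\<close>
    have same: "k y = k x" if k: "continuous_map X euclidean k" "k \<in> H m" for k m
    proof -
      have "eventually (\<lambda>n. cmod (k (s n) - k x) \<le> inverse (real (Suc n))) sequentially"
        unfolding eventually_sequentially
        using s(2) H_mono k(2) by (metis less_imp_le subsetD)
      then have "(\<lambda>n. k (s n) - k x) \<longlonglongrightarrow> 0"
        by (rule Lim_null_comparison[OF _ small])
      then have "(\<lambda>n. k (s n)) \<longlonglongrightarrow> k x"
        by (rule LIM_zero_cancel)
      from tendsto_unique[OF Unb lim_s[OF k(1)] tendsto_mono[OF Useq this]] show ?thesis .
    qed
    \<comment> \<open>The contradiction is the chain \<open>h x = h y = F y = F x\<close>. The outer
      equalities rest on \<open>same\<close>, the middle one on \<open>h = F\<close> at the points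
      \<open>s n\<close> and the continuity of both.\<close>
    have "h y = h x"
    proof (rule tendsto_unique[OF Unb h[OF y(1)]])
      have "G n y = G n x" for n
        using G_H[of n "Suc n"] by (intro same[OF G_cont]) simp
      with h[OF x] show "((\<lambda>n. G n y) \<longlongrightarrow> h x) U" by simp
    qed
    moreover have "h y = F y"
      using tendsto_unique[OF Unb lim_s[OF hc]] lim_s[OF Fc] h_T[OF s(1)] by simp
    moreover have "F y = F x"
      using same[OF Fc P(1)] .
    ultimately show False using far d(1) by simp
  qed
  have FM: "cmod (F x) \<le> M" if x: "x \<in> topspace X" for x
    using lim[OF x] M[OF Q(3) x] by (intro tendsto_upperbound[OF tendsto_norm[OF lim[OF x]]]) auto
  have "(\<lambda>n. \<phi> (\<lambda>x. G n x - F x)) \<longlonglongrightarrow> 0"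
  proof (rule bounded_convergence)
    show "cmod (G n x - F x) \<le> M + M" if "x \<in> topspace X" for n x
      using M[OF Q(3) that] FM[OF that] norm_triangle_ineq4 by (meson add_mono order_trans)
    show "(\<lambda>n. G n x - F x) \<longlonglongrightarrow> 0" if "x \<in> topspace X" for x
      using lim[OF that] by (simp add: LIM_zero)
  qed (use G_cont Fc in \<open>auto intro: continuous_map_diff\<close>)
  moreover have "\<phi> (\<lambda>x. G n x - F x) = \<phi> (G n) - \<phi> F" for n
    using linear[OF G_cont Fc, where a = 1 and b = "-1"] by simp
  ultimately have "eventually (\<lambda>n. cmod (\<phi> (G n) - \<phi> F) < e) sequentially"
    using \<open>e > 0\<close> by (auto dest: tendstoD simp: dist_norm)
  then show ?thesis
    using Q(3) by (auto simp: eventually_sequentially)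
qed

end

text \<open>Open sets of the pullback are preimages of open sets; as \<open>C\<close> consists of
  values of \<open>f\<close> on \<open>A\<close>, a cover of the preimage descends to a cover of
  \<open>C\<close>.\<close>

lemma compactin_pullback_topology:
  assumes "compactin T C" "C \<subseteq> f ` A"
  shows "compactin (pullback_topology A f T) (f -` C \<inter> A)"
  unfolding compactin_def
proof (intro conjI allI impI)
  show "f -` C \<inter> A \<subseteq> topspace (pullback_topology A f T)"
    using compactin_subset_topspace[OF assms(1)] by (auto simp: topspace_pullback_topology)
  fix \<U> assume \<U>: "(\<forall>U\<in>\<U>. openin (pullback_topology A f T) U) \<and> f -` C \<inter> A \<subseteq> \<Union>\<U>"
  let ?V = "{V. openin T V \<and> f -` V \<inter> A \<in> \<U>}"
  have "\<exists>\<F>. finite \<F> \<and> \<F> \<subseteq> ?V \<and> C \<subseteq> \<Union>\<F>"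
  proof (rule compactinD[OF assms(1)])
    show "C \<subseteq> \<Union>?V"
    proof
      fix c assume "c \<in> C"
      then obtain a where a: "a \<in> A" "c = f a" using assms(2) by blast
      then obtain U where U: "U \<in> \<U>" "a \<in> U" using \<U> \<open>c \<in> C\<close> by blast
      then obtain V where "openin T V" "U = f -` V \<inter> A"
        using \<U> unfolding openin_pullback_topology by blast
      with U a show "c \<in> \<Union>?V" by blast
    qed
  qed auto
  then obtain \<F> where "finite \<F>" "\<F> \<subseteq> ?V" "C \<subseteq> \<Union>\<F>" by blast
  then show "\<exists>\<G>. finite \<G> \<and> \<G> \<subseteq> \<U> \<and> f -` C \<inter> A \<subseteq> \<Union>\<G>"
    by (intro exI[of _ "(\<lambda>V. f -` V \<inter> A) ` \<F>"]) blast
qed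

lemma in_closure_of_product_euclidean:
  fixes p :: "'i \<Rightarrow> complex"
  assumes "p \<in> product_topology (\<lambda>_. euclidean) I closure_of A" "finite J" "J \<subseteq> I" "e > 0"
  obtains q where "q \<in> A" "\<And>i. i \<in> J \<Longrightarrow> cmod (q i - p i) < e"
proof -
  let ?P = "product_topology (\<lambda>_. euclidean :: complex topology) I"
  let ?d = "\<lambda>q. \<Sum>i\<in>J. cmod (q i - p i)"
  let ?O = "{q \<in> topspace ?P. ?d q \<in> {..<e}}"
  have "continuous_map ?P euclidean ?d"
    using assms by (intro continuous_map_sum continuous_map_norm continuous_map_diff
        continuous_map_product_coordinates) auto
  then have "openin ?P ?O"
    by (rule openin_continuous_map_preimage) auto
  moreover have "p \<in> ?O"
    using assms by (auto simp: in_closure_of)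
  ultimately obtain q where q: "q \<in> A" "q \<in> ?O"
    using assms(1) unfolding in_closure_of by meson
  have "cmod (q i - p i) < e" if "i \<in> J" for i
  proof -
    have "cmod (q i - p i) \<le> ?d q"
      using that \<open>finite J\<close> by (intro member_le_sum) auto
    with q(2) show ?thesis by simp
  qed
  with q(1) that show thesis by blast
qed

section \<open>Sup norm, point evaluations and bounded functionals\<close>

lemma sup_norm_le:
  assumes "S \<noteq> {}" "\<And>x. x \<in> S \<Longrightarrow> cmod (f x) \<le> M"
  shows "sup_norm S f \<le> M"
  unfolding sup_norm_def using assms by (intro cSUP_least)

lemma le_sup_norm:
  assumes "x \<in> S" "\<And>x. x \<in> S \<Longrightarrow> cmod (f x) \<le> M"
  shows "cmod (f x) \<le> sup_norm S f"
  unfolding sup_norm_def using assms by (intro cSUP_upper) (auto intro!: bdd_aboveI)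

lemma compact_space_bounded:
  fixes f :: "'b \<Rightarrow> complex"
  assumes "compact_space X" "continuous_map X euclidean f"
  obtains M where "\<And>x. x \<in> topspace X \<Longrightarrow> cmod (f x) \<le> M"
proof -
  have "compact (f ` topspace X)"
    using image_compactin[of X "topspace X" euclidean f] assms by (simp add: compact_space_def)
  from compact_imp_bounded[OF this] obtain M where "\<forall>y\<in>f ` topspace X. cmod y \<le> M"
    unfolding bounded_iff by blast
  then show thesis by (intro that) auto
qed

lemma topspace_weak_topology [simp]: "topspace (weak_topology S V) = V"
  by (auto simp: weak_topology_def topspace_pullback_topology)

lemma eval_bounded_functional:
  assumes "x \<in> S" "\<And>f. f \<in> V \<Longrightarrow> \<exists>M. \<forall>y\<in>S. cmod (f y) \<le> M"
  shows "(\<lambda>f. f x) \<in> bounded_functionals S V"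
  unfolding bounded_functionals_def
proof (intro CollectI conjI exI[of _ 1] ballI allI)
  fix f assume "f \<in> V"
  then obtain M where "\<forall>y\<in>S. cmod (f y) \<le> M" using assms(2) by blast
  then show "cmod (f x) \<le> 1 * sup_norm S f"
    using le_sup_norm[OF assms(1), of f M] by simp
qed (use assms(1) in simp)

text \<open>The constant in \<open>bounded_functionals\<close> may be negative; with its absolute
  value, \<open>sup_norm S f\<close> can be replaced by any pointwise bound
  \<open>M\<close>.\<close>

lemma bounded_functionals_bound:
  assumes "\<phi> \<in> bounded_functionals S V" "S \<noteq> {}"
  obtains B where "B \<ge> 0" "\<And>f M. f \<in> V \<Longrightarrow> (\<And>x. x \<in> S \<Longrightarrow> cmod (f x) \<le> M) \<Longrightarrow> cmod (\<phi> f) \<le> B * M"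
proof -
  obtain B where B: "\<And>f. f \<in> V \<Longrightarrow> cmod (\<phi> f) \<le> B * sup_norm S f"
    using assms(1) unfolding bounded_functionals_def by blast
  obtain x where x: "x \<in> S" using assms(2) by blast
  show thesis
  proof (rule that[of "\<bar>B\<bar>"])
    fix f M assume f: "f \<in> V" "\<And>x. x \<in> S \<Longrightarrow> cmod (f x) \<le> M"
    have "0 \<le> sup_norm S f" using le_sup_norm[OF x, of f M] f(2) norm_ge_zero order_trans by blast
    have "cmod (\<phi> f) \<le> \<bar>B\<bar> * sup_norm S f"
      using \<open>0 \<le> sup_norm S f\<close> by (intro order_trans[OF B[OF f(1)]] mult_right_mono) auto
    also have "\<dots> \<le> \<bar>B\<bar> * M"
      using sup_norm_le[OF assms(2) f(2)] by (intro mult_left_mono) auto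
    finally show "cmod (\<phi> f) \<le> \<bar>B\<bar> * M" .
  qed simp
qed

text \<open>Precomposition with restriction turns a functional on extensional functions into one on
  total functions, as the locale requires.\<close>

lemma bounded_functional_C_space:
  assumes X: "compact_space X" "topspace X \<noteq> {}"
    and \<phi>: "\<phi> \<in> bounded_functionals (topspace X) (C_space X)"
  obtains B where "sup_bounded_functional (X :: 'a topology) (\<lambda>f. \<phi> (restrict f (topspace X))) B"
proof -
  obtain B where B: "B \<ge> 0"
    "\<And>f M. f \<in> C_space X \<Longrightarrow> (\<And>x. x \<in> topspace X \<Longrightarrow> cmod (f x) \<le> M) \<Longrightarrow> cmod (\<phi> f) \<le> B * M"
    using bounded_functionals_bound[OF \<phi> X(2)] by blast
  have C: "restrict f (topspace X) \<in> C_space X" if "continuous_map X euclidean f" for f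
    using that by (auto simp: C_space_def intro: continuous_map_eq)
  show thesis
  proof (rule that, unfold_locales)
    fix f g :: "'a \<Rightarrow> complex" and a b assume fg: "continuous_map X euclidean f" "continuous_map X euclidean g"
    have "\<phi> (\<lambda>x\<in>topspace X. a * restrict f (topspace X) x + b * restrict g (topspace X) x) =
        a * \<phi> (restrict f (topspace X)) + b * \<phi> (restrict g (topspace X))"
      using \<phi> C[OF fg(1)] C[OF fg(2)] unfolding bounded_functionals_def by blast
    then show "\<phi> (\<lambda>x\<in>topspace X. a * f x + b * g x) =
        a * \<phi> (restrict f (topspace X)) + b * \<phi> (restrict g (topspace X))"
      by (simp cong: restrict_cong)
  next
    fix f :: "'a \<Rightarrow> complex" and M assume "continuous_map X euclidean f" "\<And>x. x \<in> topspace X \<Longrightarrow> cmod (f x) \<le> M"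
    then show "cmod (\<phi> (restrict f (topspace X))) \<le> B * M"
      by (intro B C) auto
  qed (use X B in auto)
qed

text \<open>Evaluation at all bounded functionals sends \<open>A\<close> into a product of discs, so
  the closure of its image is compact by Tychonoff. Once every point \<open>p\<close> of this
  closure is shown to be evaluation at a continuous function, the closure pulls back to a weakly
  compact set containing \<open>A\<close>.\<close>

theorem grothendieck_relatively_compact:
  assumes X: "compact_space X" "topspace X \<noteq> {}"
    and A: "A \<subseteq> C_space X"
    and M: "\<forall>g\<in>A. \<forall>x\<in>topspace X. cmod (g x) \<le> M"
    and cont: "\<And>F. pointwise_limit (topspace X) A F \<Longrightarrow> continuous_map X euclidean F"
  shows "relatively_compact_in (weak_topology (topspace X) (C_space X)) A"
proof -
  let ?S = "topspace X" and ?V = "C_space X"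
  let ?\<Phi> = "bounded_functionals ?S ?V"
  let ?P = "product_topology (\<lambda>_. euclidean :: complex topology) ?\<Phi>"
  let ?e = "\<lambda>f. \<lambda>\<phi>\<in>?\<Phi>. \<phi> f"
  let ?C = "?P closure_of (?e ` A)"
  have "\<exists>c. \<forall>f\<in>A. cmod (\<phi> f) \<le> c" if "\<phi> \<in> ?\<Phi>" for \<phi>
    using bounded_functionals_bound[OF that X(2)] A M by (metis subsetD)
  then obtain c where c: "\<And>\<phi> f. \<phi> \<in> ?\<Phi> \<Longrightarrow> f \<in> A \<Longrightarrow> cmod (\<phi> f) \<le> c \<phi>" by metis
  have Q: "compactin ?P (PiE ?\<Phi> (\<lambda>\<phi>. cball 0 (c \<phi>)))"
    by (simp add: compactin_PiE)
  have "closedin ?P (PiE ?\<Phi> (\<lambda>\<phi>. cball 0 (c \<phi>)))"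
    by (simp add: closedin_product_topology)
  then have "?C \<subseteq> PiE ?\<Phi> (\<lambda>\<phi>. cball 0 (c \<phi>))"
    using c by (intro closure_of_minimal) auto
  then have C: "compactin ?P ?C"
    using closed_compactin[OF Q] by simp
  have "?C \<subseteq> ?e ` ?V"
  proof
    fix p assume p: "p \<in> ?C"
    \<comment> \<open>Point evaluations are bounded functionals, so \<open>p\<close> itself
      prescribes the only candidate on \<open>X\<close>.\<close>
    define F where "F = (\<lambda>x\<in>?S. p (\<lambda>f. f x))"
    have ev: "(\<lambda>f. f x) \<in> ?\<Phi>" if "x \<in> ?S" for x
      using compact_space_bounded[OF X(1)]
      by (intro eval_bounded_functional that) (metis C_space_def mem_Collect_eq)
    have near: "\<exists>g\<in>A. \<forall>\<phi>\<in>J. cmod (\<phi> g - p \<phi>) < e" if "finite J" "J \<subseteq> ?\<Phi>" "e > 0" for J and e :: real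
    proof -
      obtain q where q: "q \<in> ?e ` A" "\<And>\<phi>. \<phi> \<in> J \<Longrightarrow> cmod (q \<phi> - p \<phi>) < e"
        using in_closure_of_product_euclidean[OF p \<open>finite J\<close> \<open>J \<subseteq> ?\<Phi>\<close> \<open>e > 0\<close>] by metis
      from q(1) obtain g where "g \<in> A" "q = ?e g" by (rule imageE)
      then show ?thesis using q(2) \<open>J \<subseteq> ?\<Phi>\<close> by (intro bexI[of _ g]) (force simp: subset_iff)+
    qed
    \<comment> \<open>Keeping \<open>\<phi> g\<close> near \<open>p \<phi>\<close> still leaves
      enough functions of \<open>A\<close> to approximate \<open>F\<close> pointwise;
      \<open>pointwise_limit_approx\<close> on this smaller set then forces
      \<open>p \<phi> = \<phi> F\<close>.\<close>
    have lim: "pointwise_limit ?S {g \<in> A. cmod (\<phi> g - p \<phi>) < d} F" if \<phi>: "\<phi> \<in> ?\<Phi>" and "d > 0" for \<phi> d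
      unfolding pointwise_limit_def
    proof (intro allI impI)
      fix T and e :: real assume T: "finite T" "T \<subseteq> ?S" "e > 0"
      have "\<exists>g\<in>A. \<forall>\<psi>\<in>insert \<phi> ((\<lambda>x f. f x) ` T). cmod (\<psi> g - p \<psi>) < min d e"
        using T \<phi> ev \<open>d > 0\<close> by (intro near) auto
      then show "\<exists>g\<in>{g \<in> A. cmod (\<phi> g - p \<phi>) < d}. \<forall>x\<in>T. cmod (g x - F x) < e"
        using T by (auto simp: F_def subset_iff)
    qed
    obtain x where "x \<in> ?S" using X(2) by blast
    then have FA: "pointwise_limit ?S A F"
      using lim[OF ev, of x 1] by (auto intro: pointwise_limit_mono)
    then have Fc: "continuous_map X euclidean F" by (rule cont)
    then have FV: "F \<in> ?V" by (simp add: C_space_def F_def)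
    have "p \<phi> = \<phi> F" if \<phi>: "\<phi> \<in> ?\<Phi>" for \<phi>
    proof -
      have "dist (p \<phi>) (\<phi> F) \<le> 0 + d" if "d > 0" for d
      proof -
        obtain B where "sup_bounded_functional X (\<lambda>f. \<phi> (restrict f ?S)) B"
          using bounded_functional_C_space[OF X \<phi>] .
        then interpret sup_bounded_functional X "\<lambda>f. \<phi> (restrict f ?S)" B .
        let ?A' = "{g \<in> A. cmod (\<phi> g - p \<phi>) < d / 2}"
        have d2: "d / 2 > 0" using that by simp
        have "\<exists>g\<in>?A'. cmod (\<phi> (restrict g ?S) - \<phi> (restrict F ?S)) < d / 2"
        proof (rule pointwise_limit_approx[OF _ _ _ lim[OF \<phi> d2] d2])
          show "continuous_map X euclidean G" if "pointwise_limit ?S ?A' G" for G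
            using pointwise_limit_mono[OF that] by (intro cont) auto
        qed (use A M in \<open>auto simp: C_space_def\<close>)
        then obtain g where g: "g \<in> A" "cmod (\<phi> g - p \<phi>) < d / 2"
          "cmod (\<phi> (restrict g ?S) - \<phi> (restrict F ?S)) < d / 2" by blast
        have "restrict g ?S = g" "restrict F ?S = F"
          using g(1) A FV by (auto simp: C_space_def extensional_restrict)
        with g show ?thesis
          using dist_triangle_half_r[of "\<phi> g" "p \<phi>" d "\<phi> F"] by (simp add: dist_norm)
      qed
      then show ?thesis using field_le_epsilon[of "dist (p \<phi>) (\<phi> F)" 0] by simp
    qed
    moreover have "p \<in> extensional ?\<Phi>"
      using p by (auto simp: in_closure_of PiE_iff)
    ultimately have "p = ?e F"
      by (intro extensionalityI[of _ ?\<Phi>]) auto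
    with FV show "p \<in> ?e ` ?V" by blast
  qed
  from compactin_pullback_topology[OF C this]
  have comp: "compactin (weak_topology ?S ?V) (?e -` ?C \<inter> ?V)"
    by (simp add: weak_topology_def)
  have "continuous_map (weak_topology ?S ?V) ?P (id \<circ> ?e)"
    unfolding weak_topology_def by (rule continuous_map_pullback) simp
  then have "closedin (weak_topology ?S ?V) {f \<in> ?V. ?e f \<in> ?C}"
    using closedin_continuous_map_preimage[of "weak_topology ?S ?V" ?P ?e ?C] by simp
  moreover have orbit: "?e ` A \<subseteq> ?C"
    by (rule closure_of_subset) auto
  ultimately have "weak_topology ?S ?V closure_of A \<subseteq> ?e -` ?C \<inter> ?V"
    using A orbit by (intro closure_of_minimal) (auto simp: Int_def conj_commute)
  with comp A show ?thesis
    unfolding relatively_compact_in_def using closed_compactin by fastforce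
qed

section \<open>Compactness of the hull\<close>

lemma zero_outside_supp: "x \<notin> supp f \<Longrightarrow> f x = 0"
  using closure_subset[of "support_on UNIV f"] by (auto simp: support_on_def)

lemma CcI:
  fixes f :: "'a::t2_space \<Rightarrow> 'b::real_normed_vector"
  assumes "continuous_on UNIV f" "compact K" "\<And>x. x \<notin> K \<Longrightarrow> f x = 0"
  shows "f \<in> Cc" "supp f \<subseteq> K"
proof -
  show "supp f \<subseteq> K"
    using assms by (intro closure_minimal compact_imp_closed) (auto simp: support_on_def)
  then have "compact (supp f)"
    using compact_Int_closed[OF assms(2) closed_closure, of "support_on UNIV f"] by (simp add: Int_absorb1)
  with assms(1) show "f \<in> Cc" by (simp add: Cc_def)
qed

lemma Cc_linear:
  fixes f g :: "'a::t2_space \<Rightarrow> complex"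
  assumes "f \<in> Cc" "g \<in> Cc"
  shows "(\<lambda>x. a * f x + b * g x) \<in> Cc"
  using assms zero_outside_supp[of _ f] zero_outside_supp[of _ g]
  by (intro CcI(1)[where K = "supp f \<union> supp g"]) (auto simp: Cc_def intro!: continuous_intros)

lemma Cc_bounded:
  fixes f :: "'a::topological_space \<Rightarrow> complex"
  assumes "f \<in> Cc"
  shows "\<exists>M. \<forall>x. cmod (f x) \<le> M"
proof -
  have "compact (f ` supp f)"
    using assms by (intro compact_continuous_image) (auto simp: Cc_def intro: continuous_on_subset)
  from compact_imp_bounded[OF this] obtain M where M: "\<forall>y\<in>f ` supp f. cmod y \<le> M"
    unfolding bounded_iff by blast
  have "cmod (f x) \<le> max 0 M" for x
    using M zero_outside_supp[of x f] by (cases "x \<in> supp f") auto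
  then show ?thesis by blast
qed

lemma Cc_shift:
  fixes f :: "'a::{topological_ab_group_add, t2_space} \<Rightarrow> complex"
  assumes "f \<in> Cc"
  shows "(\<lambda>x. f (t + x)) \<in> Cc" "supp (\<lambda>x. f (t + x)) \<subseteq> (+) (- t) ` supp f"
proof -
  have c: "continuous_on UNIV (\<lambda>x. f (t + x))"
    by (rule continuous_on_compose2[of UNIV f])
      (use assms in \<open>auto simp: Cc_def intro!: continuous_on_add continuous_on_const continuous_on_id\<close>)
  have k: "compact ((+) (- t) ` supp f)"
    by (rule compact_continuous_image)
      (use assms in \<open>auto simp: Cc_def intro!: continuous_on_diff continuous_on_const continuous_on_id\<close>)
  have z: "f (t + x) = 0" if "x \<notin> (+) (- t) ` supp f" for x
    using imageI[of "t + x" "supp f" "(+) (- t)"] that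
    by (intro zero_outside_supp notI) (simp add: add.assoc[symmetric])
  show "(\<lambda>x. f (t + x)) \<in> Cc" "supp (\<lambda>x. f (t + x)) \<subseteq> (+) (- t) ` supp f"
    using CcI[OF c k z] by auto
qed

lemma Cc_reflect:
  fixes f :: "'a::{topological_ab_group_add, t2_space} \<Rightarrow> complex"
  assumes "f \<in> Cc"
  shows "(\<lambda>x. f (- x)) \<in> Cc"
proof (rule CcI)
  show "continuous_on UNIV (\<lambda>x. f (- x))"
    by (rule continuous_on_compose2[of UNIV f])
      (use assms in \<open>auto simp: Cc_def intro!: continuous_on_minus continuous_on_id\<close>)
  show "compact (uminus ` supp f)"
    by (rule compact_continuous_image)
      (use assms in \<open>auto simp: Cc_def intro!: continuous_on_minus continuous_on_id\<close>)
  show "f (- x) = 0" if "x \<notin> uminus ` supp f" for x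
    using imageI[of "- x" "supp f" uminus] that by (intro zero_outside_supp notI) simp
qed

section \<open>Functionals with common bounds on compact sets\<close>

definition linear_on_Cc :: "(('a::topological_space \<Rightarrow> complex) \<Rightarrow> complex) \<Rightarrow> bool" where
  "linear_on_Cc \<nu> \<longleftrightarrow> (\<forall>f\<in>Cc. \<forall>g\<in>Cc. \<forall>a b. \<nu> (\<lambda>x. a * f x + b * g x) = a * \<nu> f + b * \<nu> g)"

text \<open>One constant \<open>C K\<close> for each compact \<open>K\<close> serves all functionals
  in the set, which makes it an analogue of the polars in the Banach-Alaoglu theorem.\<close>

definition equibounded :: "('a::topological_space set \<Rightarrow> real) \<Rightarrow> (('a \<Rightarrow> complex) \<Rightarrow> complex) set" where
  "equibounded C = {\<nu> \<in> extensional Cc. linear_on_Cc \<nu> \<and>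
     (\<forall>K g M. compact K \<longrightarrow> g \<in> Cc \<longrightarrow> supp g \<subseteq> K \<longrightarrow> (\<forall>x. cmod (g x) \<le> M) \<longrightarrow> cmod (\<nu> g) \<le> C K * M)}"

lemma topspace_inductive_limit_topology [simp]:
  "topspace inductive_limit_topology = (Cc :: ('a::t2_space \<Rightarrow> complex) set)"
proof
  show "topspace inductive_limit_topology \<subseteq> (Cc :: ('a \<Rightarrow> complex) set)"
    using openin_topspace openin_inductive_limit_topology by blast
  have V: "(Cc :: ('a \<Rightarrow> complex) set) \<in> inductive_nhds0"
    by (auto simp: inductive_nhds0_def Cc_linear intro: exI[of _ 1])
  have "openin inductive_limit_topology (Cc :: ('a \<Rightarrow> complex) set)"
    unfolding openin_inductive_limit_topology
  proof (intro conjI ballI bexI[OF _ V])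
    fix f :: "'a \<Rightarrow> complex" assume "f \<in> Cc"
    then show "(\<lambda>g x. f x + g x) ` Cc \<subseteq> Cc"
      using Cc_linear[of f _ 1 1] by auto
  qed simp
  then show "(Cc :: ('a \<Rightarrow> complex) set) \<subseteq> topspace inductive_limit_topology"
    by (rule openin_subset)
qed

text \<open>The set where \<open>|\<nu> g| \<le> e / 2\<close> is absolutely convex, and the bound
  \<open>C K\<close> makes its trace on the functions supported in \<open>K\<close> a neighbourhood
  of 0.\<close>

lemma equibounded_imp_radon:
  fixes \<nu> :: "('a::t2_space \<Rightarrow> complex) \<Rightarrow> complex"
  assumes "\<nu> \<in> equibounded C"
  shows "\<nu> \<in> radon_measures"
proof -
  have lin: "\<nu> (\<lambda>x. a * f x + b * g x) = a * \<nu> f + b * \<nu> g" if "f \<in> Cc" "g \<in> Cc" for f g a b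
    using assms that by (auto simp: equibounded_def linear_on_Cc_def)
  have bd: "cmod (\<nu> g) \<le> C K * M" if "compact K" "g \<in> Cc" "supp g \<subseteq> K" "\<And>x. cmod (g x) \<le> M" for K g M
    using assms that by (auto simp: equibounded_def)
  have "openin inductive_limit_topology {f \<in> Cc. \<nu> f \<in> U}" if U: "open U" for U
    unfolding openin_inductive_limit_topology
  proof (intro conjI ballI)
    fix f assume "f \<in> {f \<in> Cc. \<nu> f \<in> U}"
    then have f: "f \<in> Cc" "\<nu> f \<in> U" by auto
    then obtain e where e: "e > 0" "ball (\<nu> f) e \<subseteq> U" using U open_contains_ball by blast
    let ?V = "{g \<in> Cc. cmod (\<nu> g) \<le> e / 2}"
    have "?V \<in> inductive_nhds0"
      unfolding inductive_nhds0_def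
    proof (rule CollectI, intro conjI ballI allI impI)
      fix g h and a b :: complex assume g: "g \<in> ?V" "h \<in> ?V" and ab: "cmod a + cmod b \<le> 1"
      have "cmod (a * \<nu> g + b * \<nu> h) \<le> cmod a * (e / 2) + cmod b * (e / 2)"
        using g by (intro order_trans[OF norm_triangle_ineq], unfold norm_mult,
            intro add_mono mult_left_mono) auto
      also have "\<dots> = (cmod a + cmod b) * (e / 2)" by (simp add: distrib_right)
      also have "\<dots> \<le> 1 * (e / 2)" using ab e by (intro mult_right_mono) auto
      finally show "(\<lambda>x. a * g x + b * h x) \<in> ?V"
        using g lin by (auto intro: Cc_linear)
    next
      fix K :: "'a set" assume K: "compact K"
      let ?d = "e / (2 * (\<bar>C K\<bar> + 1))"
      have "cmod (\<nu> g) \<le> e / 2" if g: "g \<in> Cc" "supp g \<subseteq> K" "sup_norm UNIV g < ?d" for g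
      proof -
        obtain M where M: "\<And>x. cmod (g x) \<le> M" using Cc_bounded[OF g(1)] by blast
        have le: "cmod (g x) \<le> sup_norm UNIV g" for x
          using le_sup_norm[of x UNIV g M] M by simp
        then have nn: "0 \<le> sup_norm UNIV g" using norm_ge_zero order_trans by blast
        have "cmod (\<nu> g) \<le> C K * sup_norm UNIV g" by (rule bd[OF K g(1,2) le])
        also have "\<dots> \<le> (\<bar>C K\<bar> + 1) * sup_norm UNIV g" using nn by (intro mult_right_mono) auto
        also have "\<dots> \<le> (\<bar>C K\<bar> + 1) * ?d" using g(3) by (intro mult_left_mono) auto
        also have "\<dots> = e / 2" by (simp add: field_simps)
        finally show ?thesis .
      qed
      then show "\<exists>e>0. {f \<in> Cc. supp f \<subseteq> K \<and> sup_norm UNIV f < e} \<subseteq> ?V"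
        using e by (intro exI[of _ ?d]) auto
    qed auto
    moreover have "(\<lambda>g x. f x + g x) ` ?V \<subseteq> {f \<in> Cc. \<nu> f \<in> U}"
    proof (rule image_subsetI)
      fix g assume g: "g \<in> ?V"
      then have "\<nu> (\<lambda>x. f x + g x) = \<nu> f + \<nu> g" using lin[of f g 1 1] f by simp
      moreover have "\<nu> f + \<nu> g \<in> ball (\<nu> f) e" using g e by (simp add: dist_norm)
      ultimately show "(\<lambda>x. f x + g x) \<in> {f \<in> Cc. \<nu> f \<in> U}"
        using Cc_linear[of f g 1 1] f g e by auto
    qed
    ultimately show "\<exists>V\<in>inductive_nhds0. (\<lambda>g x. f x + g x) ` V \<subseteq> {f \<in> Cc. \<nu> f \<in> U}"
      by blast
  qed auto
  then have "continuous_map inductive_limit_topology euclidean \<nu>"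
    by (simp add: continuous_map_def)
  with assms show ?thesis
    unfolding radon_measures_def equibounded_def linear_on_Cc_def by blast
qed

abbreviation Cc_functionals :: "(('a::topological_space \<Rightarrow> complex) \<Rightarrow> complex) topology" where
  "Cc_functionals \<equiv> product_topology (\<lambda>_. euclidean) Cc"

text \<open>Banach-Alaoglu: linearity and the bounds are closed conditions, each on finitely many
  coordinates, and the bounds confine the set to a product of discs.\<close>

lemma compactin_equibounded:
  "compactin Cc_functionals (equibounded C :: (('a::t2_space \<Rightarrow> complex) \<Rightarrow> complex) set)"
proof -
  let ?P = "Cc_functionals :: (('a \<Rightarrow> complex) \<Rightarrow> complex) topology"
  have ev: "continuous_map ?P euclidean (\<lambda>\<nu>. \<nu> f)" if "f \<in> Cc" for f
    using that by (rule continuous_map_product_coordinates)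
  have "closedin ?P {\<nu> \<in> topspace ?P. \<nu> (\<lambda>x. a * f x + b * g x) - (a * \<nu> f + b * \<nu> g) \<in> {0}}"
    if "f \<in> Cc" "g \<in> Cc" for f g a b
    using ev[OF that(1)] ev[OF that(2)] ev[OF Cc_linear[OF that]]
    by (intro closedin_continuous_map_preimage[where Y = euclidean])
      (auto simp: continuous_map_atin intro!: tendsto_intros)
  then have lin: "closedin ?P {\<nu> \<in> topspace ?P. \<nu> (\<lambda>x. a * f x + b * g x) = a * \<nu> f + b * \<nu> g}"
    if "f \<in> Cc" "g \<in> Cc" for f g a b
    using that by simp
  have bd: "closedin ?P {\<nu> \<in> topspace ?P. \<nu> g \<in> cball 0 r}" if "g \<in> Cc" for g r
    using ev[OF that] by (rule closedin_continuous_map_preimage) auto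
  let ?L = "\<lambda>f g a b. {\<nu> \<in> topspace ?P. \<nu> (\<lambda>x. a * f x + b * g x) = a * \<nu> f + b * \<nu> g}"
  let ?D = "\<lambda>g r. {\<nu> \<in> topspace ?P. \<nu> g \<in> cball 0 r}"
  \<comment> \<open>Adding the whole space keeps the family nonempty and its intersection inside the
    carrier.\<close>
  let ?S = "insert (topspace ?P) ({?L f g a b | f g a b. f \<in> Cc \<and> g \<in> Cc} \<union>
    {?D g (C K * M) | K g M. compact K \<and> g \<in> Cc \<and> supp g \<subseteq> K \<and> (\<forall>x. cmod (g x) \<le> M)})"
  have "\<Inter>?S = equibounded C"
  proof (intro equalityI subsetI)
    fix \<nu> assume \<nu>: "\<nu> \<in> \<Inter>?S"
    then have "\<nu> \<in> topspace ?P" by blast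
    moreover have "\<nu> \<in> ?L f g a b" if "f \<in> Cc" "g \<in> Cc" for f g a b
      by (rule InterD[OF \<nu>], intro insertI2 UnI1 CollectI exI[of _ f] exI[of _ g] exI[of _ a] exI[of _ b] conjI refl that)
    moreover have "\<nu> \<in> ?D g (C K * M)" if "compact K" "g \<in> Cc" "supp g \<subseteq> K" "\<forall>x. cmod (g x) \<le> M" for K g M
      by (rule InterD[OF \<nu>], intro insertI2 UnI2 CollectI exI[of _ K] exI[of _ g] exI[of _ M] conjI refl that)
    ultimately show "\<nu> \<in> equibounded C"
      by (simp add: equibounded_def linear_on_Cc_def PiE_iff)
  next
    fix \<nu> assume \<nu>: "\<nu> \<in> equibounded C"
    then have top: "\<nu> \<in> topspace ?P" by (simp add: equibounded_def PiE_iff)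
    show "\<nu> \<in> \<Inter>?S"
    proof
      fix Z assume "Z \<in> ?S"
      then consider "Z = topspace ?P" | f g a b where "Z = ?L f g a b" "f \<in> Cc" "g \<in> Cc"
        | K g M where "Z = ?D g (C K * M)" "compact K" "g \<in> Cc" "supp g \<subseteq> K" "\<forall>x. cmod (g x) \<le> M"
        by blast
      then show "\<nu> \<in> Z"
        by cases (use \<nu> top in \<open>simp_all add: equibounded_def linear_on_Cc_def\<close>)
    qed
  qed
  moreover have "closedin ?P (\<Inter>?S)"
    using lin bd closedin_topspace[of ?P] by (intro closedin_Inter) auto
  ultimately have closed: "closedin ?P (equibounded C)" by simp
  have "\<forall>g\<in>Cc. \<exists>r. \<forall>\<nu>\<in>equibounded C. cmod (\<nu> g) \<le> r"
  proof
    fix g :: "'a \<Rightarrow> complex" assume g: "g \<in> Cc"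
    then obtain M where "\<forall>x. cmod (g x) \<le> M" using Cc_bounded by blast
    with g have "\<forall>\<nu>\<in>equibounded C. cmod (\<nu> g) \<le> C (supp g) * M"
      by (auto simp: equibounded_def Cc_def)
    then show "\<exists>r. \<forall>\<nu>\<in>equibounded C. cmod (\<nu> g) \<le> r" by blast
  qed
  from bchoice[OF this] obtain r where r: "\<And>g \<nu>. g \<in> Cc \<Longrightarrow> \<nu> \<in> equibounded C \<Longrightarrow> cmod (\<nu> g) \<le> r g"
    by blast
  have "compactin ?P (PiE Cc (\<lambda>g. cball 0 (r g)))"
    by (simp add: compactin_PiE)
  moreover have "equibounded C \<subseteq> PiE Cc (\<lambda>g. cball 0 (r g))"
  proof
    fix \<nu> assume \<nu>: "\<nu> \<in> equibounded C"
    then have "\<nu> \<in> extensional Cc" by (simp add: equibounded_def)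
    with r[OF _ \<nu>] show "\<nu> \<in> PiE Cc (\<lambda>g. cball 0 (r g))" by (simp add: PiE_iff)
  qed
  ultimately show ?thesis using closed closed_compactin by blast
qed

text \<open>The function \<open>|g| / M\<close> is an admissible test function for every open
  \<open>U\<close> containing \<open>A\<close>, and \<open>g / M\<close> competes in its variation
  functional.\<close>

lemma variation_ge:
  fixes \<mu> :: "('a::t2_space \<Rightarrow> complex) \<Rightarrow> complex"
  assumes \<mu>: "linear_on_Cc \<mu>" and g: "g \<in> Cc" "supp g \<subseteq> A" "\<And>x. cmod (g x) \<le> M" and M: "M > 0"
  shows "ennreal (cmod (\<mu> g) / M) \<le> variation \<mu> A"
  unfolding variation_def
proof (rule INF_greatest)
  fix U assume "U \<in> {U. open U \<and> A \<subseteq> U}"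
  then have U: "A \<subseteq> U" by simp
  let ?f = "\<lambda>x. cmod (g x) / M" and ?h = "\<lambda>x. complex_of_real (1 / M) * g x"
  have zero: "?f x = 0" if "x \<notin> supp g" for x
    using zero_outside_supp[OF that] by simp
  have "continuous_on UNIV ?f"
    using g(1) M by (auto simp: Cc_def intro!: continuous_intros)
  from CcI[OF this _ zero] have f: "?f \<in> Cc" "supp ?f \<subseteq> supp g"
    using g(1) by (auto simp: Cc_def)
  have h: "?h \<in> Cc"
    using Cc_linear[OF g(1) g(1), of "1 / M" 0] by simp
  have "\<mu> ?h = complex_of_real (1 / M) * \<mu> g"
    using \<mu>[unfolded linear_on_Cc_def, rule_format, OF g(1) g(1), of "1 / M" 0] by simp
  then have "ennreal (cmod (\<mu> g) / M) = ennreal (cmod (\<mu> ?h))"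
    using M by (simp add: norm_mult norm_divide)
  also have "\<dots> \<le> variation_functional \<mu> ?f"
    unfolding variation_functional_def using h M
    by (intro SUP_upper) (auto simp: norm_mult norm_divide)
  also have "\<dots> \<le> (SUP f\<in>{f \<in> Cc. (\<forall>x. 0 \<le> f x \<and> f x \<le> 1) \<and> supp f \<subseteq> U}. variation_functional \<mu> f)"
    using f g(2,3) U M by (intro SUP_upper) auto
  finally show "ennreal (cmod (\<mu> g) / M) \<le> \<dots>" .
qed

lemma translate_measure_apply [simp]: "f \<in> Cc \<Longrightarrow> translate_measure t \<mu> f = \<mu> (\<lambda>x. f (t + x))"
  by (simp add: translate_measure_def)

text \<open>\<open>C K\<close> is the supremum of the variation over all translates of
  \<open>K\<close>, finite by translation boundedness; shifting a function supported in
  \<open>K\<close> moves its support into such a translate.\<close>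

lemma translation_bounded_equibounded:
  fixes \<mu> :: "('a::{topological_ab_group_add, t2_space} \<Rightarrow> complex) \<Rightarrow> complex"
  assumes \<mu>: "\<mu> \<in> translation_bounded_measures"
  obtains C where "range (\<lambda>t. translate_measure t \<mu>) \<subseteq> equibounded C"
proof -
  define C where "C = (\<lambda>K. enn2real (SUP x. variation \<mu> ((+) x ` K)))"
  have lin: "linear_on_Cc \<mu>"
    using \<mu> by (simp add: translation_bounded_measures_def radon_measures_def linear_on_Cc_def)
  have zero: "\<mu> (\<lambda>x. 0) = 0"
  proof -
    have "(\<lambda>x. 0) \<in> (Cc :: ('a \<Rightarrow> complex) set)"
      by (rule CcI(1)[where K = "{}"]) auto
    then show ?thesis
      using lin[unfolded linear_on_Cc_def, rule_format, of "\<lambda>x. 0" "\<lambda>x. 0" 0 0] by simp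
  qed
  have "translate_measure t \<mu> \<in> equibounded C" for t
    unfolding equibounded_def
  proof (intro CollectI conjI allI impI)
    show "translate_measure t \<mu> \<in> extensional Cc"
      by (simp add: translate_measure_def)
    show "linear_on_Cc (translate_measure t \<mu>)"
      using lin by (auto simp: linear_on_Cc_def Cc_linear Cc_shift)
    fix K :: "'a set" and g M
    assume K: "compact K" and g: "g \<in> Cc" "supp g \<subseteq> K" and M: "\<forall>x. cmod (g x) \<le> M"
    let ?g = "\<lambda>x. g (t + x)"
    show "cmod (translate_measure t \<mu> g) \<le> C K * M"
    proof (cases "M > 0")
      case True
      have "supp ?g \<subseteq> (+) (- t) ` K"
        using Cc_shift(2)[OF g(1), of t] g(2) by blast
      then have "ennreal (cmod (\<mu> ?g) / M) \<le> variation \<mu> ((+) (- t) ` K)"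
        using M by (intro variation_ge lin Cc_shift(1) g(1) True) auto
      also have "\<dots> \<le> (SUP x. variation \<mu> ((+) x ` K))"
        by (rule SUP_upper) simp
      also have "\<dots> = ennreal (C K)"
        using \<mu> K by (simp add: C_def translation_bounded_measures_def less_top)
      finally have "cmod (\<mu> ?g) / M \<le> C K"
        by (simp add: C_def)
      with True g(1) show ?thesis by (simp add: field_simps)
    next
      case False
      have "M = 0" using M[rule_format, of 0] False norm_ge_zero[of "g 0"] by linarith
      with M have "g = (\<lambda>x. 0)" by auto
      with zero g(1) \<open>M = 0\<close> show ?thesis by simp
    qed
  qed
  with that show thesis by blast
qed

section \<open>The hull as a compact dynamical system\<close>

lemma continuous_map_euclidean_metric:
  fixes f :: "'b \<Rightarrow> 'c::metric_space"
  shows "continuous_map X euclidean f \<longleftrightarrow>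
    (\<forall>x\<in>topspace X. \<forall>e>0. \<exists>U. openin X U \<and> x \<in> U \<and> (\<forall>y\<in>U. dist (f y) (f x) < e))"
  using Met_TC.continuous_map_to_metric[of X f] by (simp add: dist_commute)

text \<open>The orbit lies in \<open>equibounded C\<close>, a closed set consisting of Radon
  measures. Hence its vague closure agrees with its closure in the full product and inherits
  compactness.\<close>

lemma hull_of_eq:
  fixes \<mu> :: "('a::{topological_ab_group_add, t2_space} \<Rightarrow> complex) \<Rightarrow> complex"
  assumes "range (\<lambda>t. translate_measure t \<mu>) \<subseteq> equibounded C"
  defines "Y \<equiv> Cc_functionals closure_of range (\<lambda>t. translate_measure t \<mu>)"
  shows "hull_of \<mu> = subtopology Cc_functionals Y" "Y \<subseteq> equibounded C" "compactin Cc_functionals Y"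
proof -
  let ?O = "range (\<lambda>t. translate_measure t \<mu>)"
  have "closedin Cc_functionals (equibounded C :: (('a \<Rightarrow> complex) \<Rightarrow> complex) set)"
    using compactin_equibounded by (intro compactin_imp_closedin) (auto simp: Hausdorff_space_product_topology)
  then show Y: "Y \<subseteq> equibounded C"
    unfolding Y_def using assms(1) by (intro closure_of_minimal)
  then show "compactin Cc_functionals Y"
    using closed_compactin[OF compactin_equibounded Y] by (simp add: Y_def)
  have sub: "equibounded C \<subseteq> radon_measures"
    using equibounded_imp_radon by blast
  have "vague_topology closure_of ?O = Y"
    using assms(1) Y sub by (auto simp: vague_topology_def closure_of_subtopology Y_def Int_absorb1)
  then show "hull_of \<mu> = subtopology Cc_functionals Y"
    using Y sub by (simp add: hull_of_def vague_topology_def subtopology_subtopology Int_absorb1)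
qed

locale translation_bounded =
  fixes \<mu> :: "('a::{topological_ab_group_add, t2_space} \<Rightarrow> complex) \<Rightarrow> complex" and C
  assumes lc: "locally_compact_space (euclidean :: 'a topology)"
    and orbit_equibounded: "range (\<lambda>t. translate_measure t \<mu>) \<subseteq> equibounded C"
    and \<mu>_ext: "\<mu> \<in> extensional Cc"
begin

abbreviation hull_set where "hull_set \<equiv> Cc_functionals closure_of range (\<lambda>t. translate_measure t \<mu>)"

lemmas hull = hull_of_eq[OF orbit_equibounded]

lemma topspace_hull [simp]: "topspace (hull_of \<mu>) = hull_set"
  using compactin_subset_topspace[OF hull(3)] by (simp add: hull(1) Int_absorb1)

lemma compact_hull: "compact_space (hull_of \<mu>)"
  using hull(3) by (simp add: hull(1) compact_space_subtopology)

lemma orbit_subset: "range (\<lambda>t. translate_measure t \<mu>) \<subseteq> hull_set"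
  by (rule closure_of_subset) (auto simp: translate_measure_def)

lemma orbit_in_hull: "translate_measure t \<mu> \<in> hull_set"
  using orbit_subset by blast

lemma hull_extensional: "\<nu> \<in> hull_set \<Longrightarrow> \<nu> \<in> extensional Cc"
  and hull_linear: "\<nu> \<in> hull_set \<Longrightarrow> f \<in> Cc \<Longrightarrow> g \<in> Cc \<Longrightarrow> \<nu> (\<lambda>x. a * f x + b * g x) = a * \<nu> f + b * \<nu> g"
  and hull_bound: "\<nu> \<in> hull_set \<Longrightarrow> compact K \<Longrightarrow> g \<in> Cc \<Longrightarrow> supp g \<subseteq> K \<Longrightarrow> (\<And>x. cmod (g x) \<le> M) \<Longrightarrow>
    cmod (\<nu> g) \<le> C K * M"
  using hull(2) unfolding equibounded_def linear_on_Cc_def by blast+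

lemma orbit_dense:
  assumes "openin (hull_of \<mu>) W" "\<nu> \<in> W"
  obtains t where "translate_measure t \<mu> \<in> W"
proof -
  obtain V where V: "openin Cc_functionals V" "W = V \<inter> hull_set"
    using assms(1) by (auto simp: hull(1) openin_subtopology)
  with assms(2) obtain t where "translate_measure t \<mu> \<in> V"
    by (auto simp: in_closure_of)
  with V orbit_in_hull that show thesis by blast
qed

lemma continuous_map_hull_coordinate: "c \<in> Cc \<Longrightarrow> continuous_map (hull_of \<mu>) euclidean (\<lambda>\<nu>. \<nu> c)"
  unfolding hull(1) by (intro continuous_map_from_subtopology continuous_map_product_coordinates)

lemma continuous_map_into_hull:
  assumes "\<And>z. z \<in> topspace Z \<Longrightarrow> f z \<in> hull_set" "\<And>c. c \<in> Cc \<Longrightarrow> continuous_map Z euclidean (\<lambda>z. f z c)"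
  shows "continuous_map Z (hull_of \<mu>) f"
  unfolding hull(1) continuous_map_in_subtopology
  using assms hull_extensional by (auto simp: continuous_map_componentwise image_subset_iff Pi_iff)

text \<open>Translation is continuous on the whole product and maps the orbit into itself, hence
  also its closure.\<close>

lemma translate_hull:
  assumes "\<nu> \<in> hull_set"
  shows "translate_measure t \<nu> \<in> hull_set"
proof -
  have "continuous_map Cc_functionals Cc_functionals (translate_measure t :: (('a \<Rightarrow> complex) \<Rightarrow> complex) \<Rightarrow> _)"
    unfolding continuous_map_componentwise
  proof (intro conjI ballI)
    fix c :: "'a \<Rightarrow> complex" assume c: "c \<in> Cc"
    then show "continuous_map Cc_functionals euclidean (\<lambda>\<nu>. translate_measure t \<nu> c)"
      using continuous_map_product_coordinates[OF Cc_shift(1)[OF c, of t]] by simp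
  qed (auto simp: translate_measure_def)
  then have "translate_measure t ` hull_set \<subseteq>
      Cc_functionals closure_of (translate_measure t ` range (\<lambda>s. translate_measure s \<mu>))"
    by (rule continuous_map_image_closure_subset)
  also have "\<dots> \<subseteq> hull_set"
  proof (rule closure_of_mono)
    have "translate_measure t (translate_measure s \<mu>) = translate_measure (t + s) \<mu>" for s
      by (auto simp: translate_measure_def restrict_def Cc_shift add.assoc add.left_commute)
    then show "translate_measure t ` range (\<lambda>s. translate_measure s \<mu>) \<subseteq> range (\<lambda>s. translate_measure s \<mu>)"
      by auto
  qed
  finally show ?thesis using assms by blast
qed

lemma translate_measure_0: "\<nu> \<in> extensional Cc \<Longrightarrow> translate_measure 0 \<nu> = \<nu>"
  by (auto simp: translate_measure_def extensional_restrict)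

lemma translate_measure_add:
  "translate_measure (s + t) (\<nu> :: ('a \<Rightarrow> complex) \<Rightarrow> complex) = translate_measure s (translate_measure t \<nu>)"
  by (auto simp: translate_measure_def restrict_def Cc_shift add.assoc add.left_commute)

text \<open>The change from \<open>c (s + x)\<close> to \<open>c (t + x)\<close> is controlled
  uniformly in \<open>\<nu>\<close> by the bound \<open>C K\<close>, the change from
  \<open>\<nu>\<^sub>0\<close> to \<open>\<nu>\<close> by one coordinate neighbourhood. Local
  compactness of the group supplies a single \<open>K\<close> for all nearby
  \<open>t\<close>.\<close>

lemma orbit_coordinate_continuous:
  assumes c: "c \<in> Cc"
  shows "continuous_map (prod_topology euclidean (hull_of \<mu>)) euclidean (\<lambda>(t, \<nu>). \<nu> (\<lambda>x. c (t + x)))"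
  unfolding continuous_map_euclidean_metric
proof (intro ballI allI impI)
  fix p and e :: real assume p: "p \<in> topspace (prod_topology (euclidean :: 'a topology) (hull_of \<mu>))" and e: "e > 0"
  obtain s \<nu>\<^sub>0 where p_eq: "p = (s, \<nu>\<^sub>0)" and \<nu>\<^sub>0: "\<nu>\<^sub>0 \<in> hull_set" using p by (cases p) auto
  obtain N\<^sub>0 N where N: "open N\<^sub>0" "compact N" "s \<in> N\<^sub>0" "N\<^sub>0 \<subseteq> N"
    using lc unfolding locally_compact_space_def by (auto simp: Ball_def) metis
  \<comment> \<open>This compact set contains the support of \<open>\<lambda>x. c (t + x)\<close>
    for every \<open>t \<in> N\<close>.\<close>
  define K where "K = (\<lambda>(k, n). k - n) ` (supp c \<times> N)"
  have K: "compact K"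
    unfolding K_def using c N(2)
    by (intro compact_continuous_image compact_Times)
      (auto simp: Cc_def split_beta intro!: continuous_on_diff continuous_on_fst continuous_on_snd continuous_on_id)
  have c_cont: "continuous_on UNIV c" using c by (simp add: Cc_def)
  have joint: "continuous_on (UNIV \<times> K) (\<lambda>(t, x). c (t + x))"
    unfolding split_beta by (rule continuous_on_compose2[OF c_cont])
      (auto intro!: continuous_on_add continuous_on_fst continuous_on_snd continuous_on_id)
  define d where "d = e / (2 * (\<bar>C K\<bar> + 1))"
  have d: "d > 0" using e by (simp add: d_def)
  obtain N\<^sub>1 where N1: "s \<in> N\<^sub>1" "open N\<^sub>1"
    "\<forall>t\<in>N\<^sub>1 \<inter> UNIV. \<forall>x\<in>K. dist (case (t, x) of (t, x) \<Rightarrow> c (t + x)) (case (s, x) of (t, x) \<Rightarrow> c (t + x)) \<le> d"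
    using continuous_on_prod_compactE[OF joint K UNIV_I d] by metis
  let ?c = "\<lambda>x. c (s + x)"
  let ?V = "{\<nu> \<in> topspace (hull_of \<mu>). \<nu> ?c \<in> ball (\<nu>\<^sub>0 ?c) (e / 2)}"
  have V: "openin (hull_of \<mu>) ?V"
    by (rule openin_continuous_map_preimage[OF continuous_map_hull_coordinate[OF Cc_shift(1)[OF c]]]) auto
  let ?U = "(N\<^sub>0 \<inter> N\<^sub>1) \<times> ?V"
  have "openin (prod_topology euclidean (hull_of \<mu>)) ?U"
    using N(1) N1(2) V by (simp add: openin_prod_Times_iff open_Int)
  moreover have "p \<in> ?U"
    using N(3) N1(1) \<nu>\<^sub>0 e by (simp add: p_eq)
  moreover have "dist (case q of (t, \<nu>) \<Rightarrow> \<nu> (\<lambda>x. c (t + x))) (case p of (t, \<nu>) \<Rightarrow> \<nu> (\<lambda>x. c (t + x))) < e"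
    if q: "q \<in> ?U" for q
  proof -
    obtain t \<nu> where q_eq: "q = (t, \<nu>)" and t: "t \<in> N\<^sub>0" "t \<in> N\<^sub>1" and \<nu>: "\<nu> \<in> hull_set" "dist (\<nu>\<^sub>0 ?c) (\<nu> ?c) < e / 2"
      using q by (cases q) auto
    let ?h = "\<lambda>x. 1 * c (t + x) + (-1) * c (s + x)"
    have zero: "?h x = 0" if "x \<notin> K" for x
    proof -
      have "n + x \<notin> supp c" if n: "n \<in> N" for n
      proof
        assume "n + x \<in> supp c"
        then have "(\<lambda>(k, n). k - n) (n + x, n) \<in> K" unfolding K_def using n by (intro imageI) simp
        with \<open>x \<notin> K\<close> show False by simp
      qed
      then have "t + x \<notin> supp c" "s + x \<notin> supp c" using t N by auto
      then show ?thesis using zero_outside_supp[of "t + x" c] zero_outside_supp[of "s + x" c] by simp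
    qed
    have h: "?h \<in> Cc" by (intro Cc_linear Cc_shift c)
    then have "continuous_on UNIV ?h" by (simp add: Cc_def)
    from CcI(2)[OF this K zero] have "supp ?h \<subseteq> K" .
    moreover have "cmod (?h x) \<le> d" for x
    proof (cases "x \<in> K")
      case True
      then show ?thesis using N1(3) t(2) by (simp add: dist_norm)
    next
      case False
      then show ?thesis using zero[OF False] d by simp
    qed
    ultimately have "cmod (\<nu> ?h) \<le> C K * d"
      by (intro hull_bound[OF \<nu>(1) K h])
    also have "\<dots> \<le> \<bar>C K\<bar> * d" using d by (intro mult_right_mono) auto
    also have "\<dots> < e / 2" using e by (simp add: d_def field_simps)
    finally have "cmod (\<nu> (\<lambda>x. c (t + x)) - \<nu> ?c) < e / 2"
      using hull_linear[OF \<nu>(1) Cc_shift(1)[OF c, of t] Cc_shift(1)[OF c, of s], of 1 "-1"] by simp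
    with \<nu>(2) show ?thesis
      unfolding p_eq q_eq prod.case
      using dist_triangle_half_r[of "\<nu> ?c" "\<nu> (\<lambda>x. c (t + x))" e "\<nu>\<^sub>0 ?c"]
      by (simp add: dist_norm norm_minus_commute)
  qed
  ultimately show "\<exists>U. openin (prod_topology euclidean (hull_of \<mu>)) U \<and> p \<in> U \<and>
      (\<forall>q\<in>U. dist (case q of (t, \<nu>) \<Rightarrow> \<nu> (\<lambda>x. c (t + x))) (case p of (t, \<nu>) \<Rightarrow> \<nu> (\<lambda>x. c (t + x))) < e)"
    by blast
qed

lemma continuous_action:
  "continuous_map (prod_topology euclidean (hull_of \<mu>)) (hull_of \<mu>) (\<lambda>(t, \<nu>). translate_measure t \<nu>)"
proof (rule continuous_map_into_hull)
  fix c :: "'a \<Rightarrow> complex" assume c: "c \<in> Cc"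
  have "(\<lambda>z. (case z of (t, \<nu>) \<Rightarrow> translate_measure t \<nu>) c) = (\<lambda>(t, \<nu>). \<nu> (\<lambda>x. c (t + x)))"
    using c by auto
  then show "continuous_map (prod_topology euclidean (hull_of \<mu>)) euclidean
      (\<lambda>z. (case z of (t, \<nu>) \<Rightarrow> translate_measure t \<nu>) c)"
    using orbit_coordinate_continuous[OF c] by simp
qed (auto intro: translate_hull)

lemma dynamical_system_hull: "dynamical_system (hull_of \<mu>) translate_measure"
  unfolding dynamical_system_def
  using compact_hull continuous_action translate_measure_0 hull_extensional translate_measure_add by auto

lemma continuous_translate: "continuous_map (hull_of \<mu>) (hull_of \<mu>) (translate_measure t)"
proof -
  have "continuous_map (hull_of \<mu>) (prod_topology euclidean (hull_of \<mu>)) (\<lambda>\<nu>. (t, \<nu>))"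
    by (simp add: continuous_map_pairwise o_def)
  from continuous_map_compose[OF this continuous_action] show ?thesis
    by (simp add: o_def)
qed

text \<open>The tube lemma around \<open>{0} \<times> hull_set\<close>: compactness of the hull
  turns joint continuity at \<open>t = 0\<close> into uniformity in \<open>\<nu>\<close>.\<close>

lemma uniform_translate:
  fixes f :: "(('a \<Rightarrow> complex) \<Rightarrow> complex) \<Rightarrow> complex"
  assumes f: "continuous_map (hull_of \<mu>) euclidean f" and "e > 0"
  obtains U where "open U" "0 \<in> U" "\<And>t \<nu>. t \<in> U \<Longrightarrow> \<nu> \<in> hull_set \<Longrightarrow> dist (f (translate_measure t \<nu>)) (f \<nu>) < e"
proof -
  let ?P = "prod_topology (euclidean :: 'a topology) (hull_of \<mu>)"
  let ?h = "\<lambda>p. f (case p of (t, \<nu>) \<Rightarrow> translate_measure t \<nu>) - f (snd p)"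
  let ?W = "{p \<in> topspace ?P. ?h p \<in> ball 0 e}"
  have "continuous_map ?P euclidean ?h"
    using continuous_map_compose[OF continuous_action f] continuous_map_compose[OF continuous_map_snd f]
    by (intro continuous_map_diff) (simp_all add: o_def)
  then have W: "openin ?P ?W"
    by (rule openin_continuous_map_preimage) auto
  have "{0} \<times> hull_set \<subseteq> ?W"
    using \<open>e > 0\<close> by (auto simp: translate_measure_0[OF hull_extensional])
  then obtain U V where "open U" "0 \<in> U" "hull_set \<subseteq> V" "U \<times> V \<subseteq> ?W"
    using tube_lemma_right[OF W, of hull_set 0] compact_hull unfolding compact_space_def by auto
  then show thesis
    by (intro that[of U]) (auto simp: dist_norm subset_iff norm_minus_commute)
qed

end

section \<open>Weak almost periodicity\<close>

text \<open>Converse of \<open>pointwise_limit_ultra\<close>: the sets of approximating indices form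
  a filter base. The ultrafilter lives on the indices, later group elements, so further limits can
  be taken along it.\<close>

lemma pointwise_limit_range_ultra:
  assumes "pointwise_limit S (range g) F"
  obtains U where "ultra U" "\<And>x. x \<in> S \<Longrightarrow> ((\<lambda>t. g t x) \<longlongrightarrow> F x) U"
proof -
  let ?I = "{(T, e :: real). finite T \<and> T \<subseteq> S \<and> e > 0}"
  define B where "B = (\<lambda>(T, e). principal {t. \<forall>x\<in>T. cmod (g t x - F x) < e}) ` ?I"
  have ev: "eventually P (Inf B) \<longleftrightarrow> (\<exists>b\<in>B. eventually P b)" for P
  proof (rule eventually_Inf_base)
    show "B \<noteq> {}" by (auto simp: B_def intro!: exI[of _ "{}"] exI[of _ 1])
    fix b b' assume "b \<in> B" "b' \<in> B"
    then obtain T e T' e' where *: "(T, e) \<in> ?I" "(T', e') \<in> ?I"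
      "b = principal {t. \<forall>x\<in>T. cmod (g t x - F x) < e}"
      "b' = principal {t. \<forall>x\<in>T'. cmod (g t x - F x) < e'}"
      unfolding B_def by auto
    show "\<exists>x\<in>B. x \<le> inf b b'"
      unfolding B_def *(3,4) using *(1,2)
      by (intro bexI[OF _ imageI[of "(T \<union> T', min e e')"]]) auto
  qed
  have "Inf B \<noteq> bot"
    unfolding trivial_limit_def ev
  proof
    assume "\<exists>b\<in>B. eventually (\<lambda>x. False) b"
    then obtain T e where "finite T" "T \<subseteq> S" "e > 0" "\<And>t. \<not> (\<forall>x\<in>T. cmod (g t x - F x) < e)"
      by (auto simp: B_def eventually_principal)
    then show False using assms unfolding pointwise_limit_def by blast
  qed
  then obtain U where U: "U \<le> Inf B" "ultra U" by (rule ultra_le_ex)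
  show thesis
  proof (rule that[OF U(2)])
    fix x assume x: "x \<in> S"
    show "((\<lambda>t. g t x) \<longlongrightarrow> F x) U"
    proof (rule tendstoI)
      fix e :: real assume "e > 0"
      with x have "eventually (\<lambda>t. dist (g t x) (F x) < e) (Inf B)"
        unfolding ev unfolding B_def by (intro bexI[OF _ imageI[of "({x}, e)"]]) (auto simp: eventually_principal dist_norm)
      then show "eventually (\<lambda>t. dist (g t x) (F x) < e) U"
        using U(1) by (rule filter_leD[rotated])
    qed
  qed
qed

lemma continuous_map_weak_topology:
  assumes "\<psi> \<in> bounded_functionals S V"
  shows "continuous_map (weak_topology S V) euclidean \<psi>"
proof -
  let ?\<Phi> = "bounded_functionals S V"
  have "continuous_map (weak_topology S V) euclidean ((\<lambda>p. p \<psi>) \<circ> (\<lambda>f. \<lambda>\<phi>\<in>?\<Phi>. \<phi> f))"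
    unfolding weak_topology_def
    by (intro continuous_map_pullback continuous_map_product_coordinates assms)
  with assms show ?thesis by (simp add: o_def)
qed

lemma continuous_map_into_weak_topology:
  assumes "\<And>z. z \<in> topspace Z \<Longrightarrow> J z \<in> V"
    and "\<And>\<phi>. \<phi> \<in> bounded_functionals S V \<Longrightarrow> continuous_map Z euclidean (\<lambda>z. \<phi> (J z))"
  shows "continuous_map Z (weak_topology S V) J"
  unfolding weak_topology_def using assms
  by (intro continuous_map_pullback') (auto simp: continuous_map_componentwise)

lemma Cu_bounded: "f \<in> Cu \<Longrightarrow> \<exists>M. \<forall>x. cmod (f x) \<le> M"
  by (auto simp: Cu_def bounded_iff)

text \<open>Point evaluations are bounded functionals and separate functions. This makes weakly
  compact subsets of \<open>Cu\<close> closed.\<close>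

lemma Hausdorff_weak_Cu: "Hausdorff_space (weak_topology UNIV (Cu :: ('a::topological_ab_group_add \<Rightarrow> complex) set))"
proof (rule Hausdorff_space_injective_preimage)
  show "Hausdorff_space (product_topology (\<lambda>_. euclidean) (UNIV :: 'a set) :: ('a \<Rightarrow> complex) topology)"
    by (simp add: Hausdorff_space_product_topology)
  show "continuous_map (weak_topology UNIV Cu) (product_topology (\<lambda>_. euclidean) UNIV) (\<lambda>f :: 'a \<Rightarrow> complex. f)"
    using Cu_bounded
    by (auto simp: continuous_map_componentwise_UNIV intro!: continuous_map_weak_topology eval_bounded_functional)
qed auto

section \<open>Functions on the group read off along the orbit\<close>

context translation_bounded
begin

text \<open>The sign of \<open>- x\<close> is chosen so that composing \<open>f\<close> with
  translation by \<open>t\<close> becomes \<open>translate_fun t\<close>, and coordinates become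
  convolutions.\<close>

definition orbit_fun :: "((('a \<Rightarrow> complex) \<Rightarrow> complex) \<Rightarrow> complex) \<Rightarrow> 'a \<Rightarrow> complex" where
  "orbit_fun f = (\<lambda>x. f (translate_measure (- x) \<mu>))"

lemma orbit_fun_Cu:
  assumes f: "continuous_map (hull_of \<mu>) euclidean f"
  shows "orbit_fun f \<in> Cu"
  unfolding Cu_def
proof (intro CollectI conjI allI impI)
  obtain M where "\<And>\<nu>. \<nu> \<in> hull_set \<Longrightarrow> cmod (f \<nu>) \<le> M"
    using compact_space_bounded[OF compact_hull f] topspace_hull by metis
  then show "bounded (range (orbit_fun f))"
    using orbit_in_hull unfolding bounded_iff orbit_fun_def by blast
  fix e :: real assume "e > 0"
  then obtain U where U: "open U" "0 \<in> U"
    "\<And>t \<nu>. t \<in> U \<Longrightarrow> \<nu> \<in> hull_set \<Longrightarrow> dist (f (translate_measure t \<nu>)) (f \<nu>) < e"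
    using uniform_translate[OF f] by metis
  have "open (uminus -` U)"
    by (intro open_vimage U(1) continuous_on_minus continuous_on_id)
  moreover have "dist (orbit_fun f x) (orbit_fun f y) < e" if "x - y \<in> uminus -` U" for x y
  proof -
    have "translate_measure (- x) \<mu> = translate_measure (- (x - y)) (translate_measure (- y) \<mu>)"
      by (simp flip: translate_measure_add)
    with that U(3)[OF _ orbit_in_hull, of "- (x - y)" "- y"] show ?thesis
      by (simp add: orbit_fun_def)
  qed
  ultimately show "\<exists>U. open U \<and> 0 \<in> U \<and> (\<forall>x y. x - y \<in> U \<longrightarrow> dist (orbit_fun f x) (orbit_fun f y) < e)"
    using U(2) by (intro exI[of _ "uminus -` U"]) auto
qed

lemma orbit_fun_translate:
  "orbit_fun (\<lambda>\<nu>\<in>hull_set. f (translate_measure t \<nu>)) = translate_fun t (orbit_fun f)"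
  by (rule ext) (simp add: orbit_fun_def translate_fun_def orbit_in_hull flip: translate_measure_add)

lemma translate_orbit_fun:
  "translate_fun t (orbit_fun f) x = f (translate_measure t (translate_measure (- x) \<mu>))"
  by (simp add: orbit_fun_def translate_fun_def flip: translate_measure_add)

text \<open>The reflection cancels the sign: translating \<open>\<mu>\<close> by \<open>- x\<close>
  and testing with \<open>\<lambda>s. c (- s)\<close> applies \<open>\<mu>\<close> to
  \<open>\<lambda>s. c (x - s)\<close>.\<close>

lemma orbit_fun_coordinate:
  assumes "c \<in> Cc"
  shows "orbit_fun (\<lambda>\<nu>\<in>hull_set. \<nu> (\<lambda>s. c (- s))) = conv c \<mu>"
  using Cc_reflect[OF assms] by (auto simp: orbit_fun_def conv_def orbit_in_hull)

text \<open>Since \<open>orbit_fun\<close> is linear and does not increase the sup norm, bounded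
  functionals on \<open>Cu\<close> pull back to bounded functionals on
  \<open>C_space (hull_of \<mu>)\<close>.\<close>

lemma continuous_map_orbit_fun:
  "continuous_map (weak_topology hull_set (C_space (hull_of \<mu>))) (weak_topology UNIV Cu) orbit_fun"
proof (rule continuous_map_into_weak_topology)
  show "orbit_fun f \<in> Cu" if "f \<in> topspace (weak_topology hull_set (C_space (hull_of \<mu>)))" for f
    using that by (auto simp: C_space_def intro: orbit_fun_Cu)
next
  fix \<phi> :: "('a \<Rightarrow> complex) \<Rightarrow> complex" assume \<phi>: "\<phi> \<in> bounded_functionals UNIV Cu"
  obtain B where B: "B \<ge> 0"
    "\<And>f M. f \<in> Cu \<Longrightarrow> (\<And>x. x \<in> UNIV \<Longrightarrow> cmod (f x) \<le> M) \<Longrightarrow> cmod (\<phi> f) \<le> B * M"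
    using bounded_functionals_bound[OF \<phi> UNIV_not_empty] by blast
  have Cu: "orbit_fun f \<in> Cu" if "f \<in> C_space (hull_of \<mu>)" for f
    using that by (auto simp: C_space_def intro: orbit_fun_Cu)
  have "(\<lambda>f. \<phi> (orbit_fun f)) \<in> bounded_functionals hull_set (C_space (hull_of \<mu>))"
    unfolding bounded_functionals_def
  proof (intro CollectI conjI ballI allI exI[of _ B])
    fix f g a b assume "f \<in> C_space (hull_of \<mu>)" "g \<in> C_space (hull_of \<mu>)"
    then have "\<phi> (\<lambda>x\<in>UNIV. a * orbit_fun f x + b * orbit_fun g x) = a * \<phi> (orbit_fun f) + b * \<phi> (orbit_fun g)"
      using \<phi> Cu unfolding bounded_functionals_def by blast
    moreover have "orbit_fun (\<lambda>x\<in>hull_set. a * f x + b * g x) = (\<lambda>x\<in>UNIV. a * orbit_fun f x + b * orbit_fun g x)"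
      by (auto simp: orbit_fun_def orbit_in_hull)
    ultimately show "\<phi> (orbit_fun (\<lambda>x\<in>hull_set. a * f x + b * g x)) = a * \<phi> (orbit_fun f) + b * \<phi> (orbit_fun g)"
      by simp
  next
    fix f assume f: "f \<in> C_space (hull_of \<mu>)"
    then obtain M where "\<And>\<nu>. \<nu> \<in> hull_set \<Longrightarrow> cmod (f \<nu>) \<le> M"
      using compact_space_bounded[OF compact_hull, of f] by (auto simp: C_space_def)
    then have "cmod (f \<nu>) \<le> sup_norm hull_set f" if "\<nu> \<in> hull_set" for \<nu>
      using le_sup_norm[OF that] by blast
    then show "cmod (\<phi> (orbit_fun f)) \<le> B * sup_norm hull_set f"
      using orbit_in_hull by (intro B(2) Cu f) (simp add: orbit_fun_def)
  qed
  then show "continuous_map (weak_topology hull_set (C_space (hull_of \<mu>))) euclidean (\<lambda>f. \<phi> (orbit_fun f))"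
    by (rule continuous_map_weak_topology)
qed

text \<open>The weakly compact orbit closure of a coordinate function has a compact, hence closed,
  image under \<open>orbit_fun\<close>. This image contains the translates of
  \<open>conv c \<mu>\<close> and therefore their closure.\<close>

lemma wap_function_conv:
  assumes wap: "wap_dynamical_system (hull_of \<mu>) translate_measure" and c: "c \<in> Cc"
  shows "wap_function (conv c \<mu>)"
proof -
  let ?W = "weak_topology hull_set (C_space (hull_of \<mu>))" and ?W' = "weak_topology UNIV Cu :: ('a \<Rightarrow> complex) topology"
  define f where "f = (\<lambda>\<nu>\<in>hull_set. \<nu> (\<lambda>s. c (- s)))"
  have fc: "continuous_map (hull_of \<mu>) euclidean f"
    by (rule continuous_map_eq[OF continuous_map_hull_coordinate[OF Cc_reflect[OF c]]]) (simp add: f_def)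
  have conv: "orbit_fun f = conv c \<mu>"
    using orbit_fun_coordinate[OF c] by (simp add: f_def)
  let ?A = "range (\<lambda>t. \<lambda>\<nu>\<in>hull_set. f (translate_measure t \<nu>))"
  have "f \<in> C_space (hull_of \<mu>)" using fc by (simp add: C_space_def f_def)
  with wap have A: "?A \<subseteq> C_space (hull_of \<mu>)" "compactin ?W (?W closure_of ?A)"
    unfolding wap_dynamical_system_def relatively_compact_in_def by auto
  let ?K = "orbit_fun ` (?W closure_of ?A)"
  have K: "compactin ?W' ?K"
    using image_compactin[OF A(2) continuous_map_orbit_fun] .
  have "orbit_fun ` ?A \<subseteq> ?K"
    using closure_of_subset[of ?A ?W] A(1) by (intro image_mono) simp
  moreover have img: "orbit_fun ` ?A = range (\<lambda>t. translate_fun t (conv c \<mu>))"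
    by (simp add: image_image orbit_fun_translate conv)
  ultimately have "?W' closure_of range (\<lambda>t. translate_fun t (conv c \<mu>)) \<subseteq> ?K"
    using compactin_imp_closedin[OF Hausdorff_weak_Cu K] by (intro closure_of_minimal) auto
  then have "compactin ?W' (?W' closure_of range (\<lambda>t. translate_fun t (conv c \<mu>)))"
    using closed_compactin[OF K] by simp
  moreover have "range (\<lambda>t. translate_fun t (conv c \<mu>)) \<subseteq> Cu"
    using A(1) unfolding img[symmetric] by (auto simp: C_space_def intro!: orbit_fun_Cu)
  ultimately show ?thesis
    using orbit_fun_Cu[OF fc] by (simp add: wap_function_def relatively_compact_in_def conv)
qed

text \<open>Evaluation at a point of the hull corresponds, on the functions \<^term>\<open>orbit_fun f\<close>, to the
  limit along an ultrafilter \<open>V\<close> of the group; the latter is a bounded functional on all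
  of \<^const>\<open>Cu\<close>, so no extension theorem for functionals is needed.\<close>
lemma ultra_limit_along_orbit:
  assumes f: "continuous_map (hull_of \<mu>) euclidean f"
    and U: "ultra U" and h: "limitin (weak_topology UNIV Cu) (\<lambda>t. translate_fun t (orbit_fun f)) h U"
    and F: "((\<lambda>t. f (translate_measure t \<omega>)) \<longlongrightarrow> F) U"
    and V: "ultra V" "limitin (hull_of \<mu>) (\<lambda>x. translate_measure (- x) \<mu>) \<omega> V"
  shows "(h \<longlongrightarrow> F) V"
proof -
  have Vnb: "V \<noteq> bot" and Unb: "U \<noteq> bot" using V(1) U by (simp_all add: ultra_def)
  define \<phi> where "\<phi> = (\<lambda>k :: 'a \<Rightarrow> complex. Lim V k)"
  have lim: "(k \<longlongrightarrow> \<phi> k) V" if "k \<in> Cu" for k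
  proof -
    from Cu_bounded[OF that] obtain M where "\<forall>x. cmod (k x) \<le> M" by blast
    then obtain l where "(k \<longlongrightarrow> l) V" using ultra_tendsto_bounded[OF V(1), of k M] by blast
    moreover from this have "Lim V k = l" by (rule tendsto_Lim[OF Vnb])
    ultimately show ?thesis by (simp add: \<phi>_def)
  qed
  have "\<phi> \<in> bounded_functionals UNIV Cu"
    unfolding bounded_functionals_def
  proof (intro CollectI conjI ballI allI exI[of _ 1])
    fix k l :: "'a \<Rightarrow> complex" and a b assume "k \<in> Cu" "l \<in> Cu"
    then have "((\<lambda>x. a * k x + b * l x) \<longlongrightarrow> a * \<phi> k + b * \<phi> l) V"
      by (intro tendsto_intros lim)
    from tendsto_Lim[OF Vnb this] show "\<phi> (\<lambda>x\<in>UNIV. a * k x + b * l x) = a * \<phi> k + b * \<phi> l"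
      by (simp add: \<phi>_def restrict_UNIV)
  next
    fix k :: "'a \<Rightarrow> complex" assume k: "k \<in> Cu"
    then obtain M where "\<forall>x. cmod (k x) \<le> M" using Cu_bounded by blast
    then have "cmod (k x) \<le> sup_norm UNIV k" for x using le_sup_norm[of x UNIV k M] by simp
    then show "cmod (\<phi> k) \<le> 1 * sup_norm UNIV k"
      using tendsto_upperbound[OF tendsto_norm[OF lim[OF k]] _ Vnb] by simp
  qed
  then have cont: "continuous_map (weak_topology UNIV Cu) euclidean \<phi>"
    by (rule continuous_map_weak_topology)
  have hCu: "h \<in> Cu" using limitin_topspace[OF h] by simp
  \<comment> \<open>With this identity, weak convergence of the translates to \<open>h\<close>,
    tested on \<open>\<phi>\<close>, gives \<open>\<phi> h = F\<close>.\<close>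
  have "\<phi> (translate_fun t (orbit_fun f)) = f (translate_measure t \<omega>)" for t
  proof -
    have "limitin euclidean ((f \<circ> translate_measure t) \<circ> (\<lambda>x. translate_measure (- x) \<mu>))
        ((f \<circ> translate_measure t) \<omega>) V"
      using continuous_map_limit[OF continuous_map_compose[OF continuous_translate f] V(2)] .
    then have "(translate_fun t (orbit_fun f) \<longlongrightarrow> f (translate_measure t \<omega>)) V"
      by (simp add: o_def translate_orbit_fun[abs_def])
    then show ?thesis using tendsto_Lim[OF Vnb] by (simp add: \<phi>_def)
  qed
  then have "((\<lambda>t. f (translate_measure t \<omega>)) \<longlongrightarrow> \<phi> h) U"
    using continuous_map_limit[OF cont h] by (simp add: o_def)
  then have "\<phi> h = F" using tendsto_unique[OF Unb] F by blast
  with lim[OF hCu] show ?thesis by simp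
qed

text \<open>Weak compactness provides one \<open>h\<close> for all \<open>\<omega>\<close>, and
  \<open>F \<omega>\<close> is its limit along the orbit filter at \<open>\<omega>\<close>. Limits
  of one function along a dense orbit depend continuously on the point, as in extension by
  continuity into a regular space.\<close>

lemma continuous_ultra_limit:
  assumes f: "continuous_map (hull_of \<mu>) euclidean f"
    and wap: "relatively_compact_in (weak_topology UNIV Cu) (range (\<lambda>t. translate_fun t (orbit_fun f)))"
    and U: "ultra U" and F: "\<And>\<omega>. \<omega> \<in> hull_set \<Longrightarrow> ((\<lambda>t. f (translate_measure t \<omega>)) \<longlongrightarrow> F \<omega>) U"
  shows "continuous_map (hull_of \<mu>) euclidean F"
proof -
  let ?W = "weak_topology UNIV Cu :: ('a \<Rightarrow> complex) topology"
  let ?o = "\<lambda>x. translate_measure (- x) \<mu>"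
  let ?N = "\<lambda>\<omega>. filtercomap ?o (nhdsin (hull_of \<mu>) \<omega>)"
  let ?R = "range (\<lambda>t. translate_fun t (orbit_fun f))"
  have "?R \<subseteq> ?W closure_of ?R"
    using wap by (intro closure_of_subset) (simp add: relatively_compact_in_def)
  then have "eventually (\<lambda>t. translate_fun t (orbit_fun f) \<in> ?W closure_of ?R) U"
    by (intro always_eventually) blast
  then obtain h where h: "limitin ?W (\<lambda>t. translate_fun t (orbit_fun f)) h U"
    using ultra_limitin_compactin[OF U] wap unfolding relatively_compact_in_def by metis
  have lim_orbit: "limitin (hull_of \<mu>) ?o \<omega> V" if "\<omega> \<in> hull_set" "V \<le> ?N \<omega>" for \<omega> V
    unfolding limitin_def
  proof (intro conjI allI impI)
    fix W assume "openin (hull_of \<mu>) W \<and> \<omega> \<in> W"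
    then have "eventually (\<lambda>x. ?o x \<in> W) (?N \<omega>)"
      unfolding eventually_filtercomap eventually_nhdsin
      by (intro exI[of _ "\<lambda>\<nu>. \<nu> \<in> W"] conjI disjI2 exI[of _ W]) auto
    with that(2) show "eventually (\<lambda>x. ?o x \<in> W) V" by (rule filter_leD)
  qed (use that in simp)
  have lim_h: "(h \<longlongrightarrow> F \<omega>) V" if "\<omega> \<in> hull_set" "ultra V" "V \<le> ?N \<omega>" for \<omega> V
    using ultra_limit_along_orbit[OF f U h F[OF that(1)] that(2) lim_orbit[OF that(1,3)]] .
  show ?thesis
    unfolding continuous_map_euclidean_metric
  proof (intro ballI allI impI)
    fix \<omega> and e :: real assume "\<omega> \<in> topspace (hull_of \<mu>)" and e: "e > 0"
    then have \<omega>: "\<omega> \<in> hull_set" by simp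
    \<comment> \<open>Convergence along every finer ultrafilter gives convergence along the filter:
      otherwise some ultrafilter would live on the points violating the estimate.\<close>
    have "eventually (\<lambda>x. dist (h x) (F \<omega>) < e / 2) (?N \<omega>)"
    proof (rule ccontr)
      assume "\<not> ?thesis"
      then have "inf (?N \<omega>) (principal {x. \<not> dist (h x) (F \<omega>) < e / 2}) \<noteq> bot"
        by (simp add: trivial_limit_def eventually_inf_principal)
      then obtain V where V: "V \<le> inf (?N \<omega>) (principal {x. \<not> dist (h x) (F \<omega>) < e / 2})" "ultra V"
        by (rule ultra_le_ex)
      then have "eventually (\<lambda>x. \<not> dist (h x) (F \<omega>) < e / 2) V"
        by (simp add: le_principal)
      moreover have "eventually (\<lambda>x. dist (h x) (F \<omega>) < e / 2) V"
        using V e by (intro tendstoD[OF lim_h[OF \<omega>]]) auto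
      ultimately have "eventually (\<lambda>x. False) V"
        by eventually_elim simp
      with V(2) show False by (simp add: ultra_def trivial_limit_def)
    qed
    then obtain W where W: "openin (hull_of \<mu>) W" "\<omega> \<in> W" "\<And>x. ?o x \<in> W \<Longrightarrow> dist (h x) (F \<omega>) < e / 2"
      using \<omega> unfolding eventually_filtercomap eventually_nhdsin by auto
    have "dist (F \<omega>') (F \<omega>) < e" if \<omega>': "\<omega>' \<in> W" for \<omega>'
    proof -
      have in_hull: "\<omega>' \<in> hull_set" using openin_subset[OF W(1)] \<omega>' by auto
      \<comment> \<open>Density of the orbit makes the filter at \<open>\<omega>'\<close> proper, so
        an ultrafilter computing \<open>F \<omega>'\<close> exists.\<close>
      have "?N \<omega>' \<noteq> bot"
      proof
        assume "?N \<omega>' = bot"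
        then have "eventually (\<lambda>x. False) (?N \<omega>')" by simp
        then obtain S where "openin (hull_of \<mu>) S" "\<omega>' \<in> S" "\<And>x. ?o x \<notin> S"
          using in_hull unfolding eventually_filtercomap eventually_nhdsin by auto
        then show False using orbit_dense[of S \<omega>'] by (metis minus_minus)
      qed
      then obtain V where V: "V \<le> ?N \<omega>'" "ultra V" by (rule ultra_le_ex)
      have "eventually (\<lambda>x. ?o x \<in> W) V"
        using limitinD[OF lim_orbit[OF in_hull V(1)] W(1) \<omega>'] .
      then have "eventually (\<lambda>x. dist (h x) (F \<omega>) \<le> e / 2) V"
        by eventually_elim (use W(3) in \<open>auto intro: less_imp_le\<close>)
      moreover have "((\<lambda>x. dist (h x) (F \<omega>)) \<longlongrightarrow> dist (F \<omega>') (F \<omega>)) V"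
        by (intro tendsto_intros lim_h[OF in_hull V(2,1)])
      ultimately have "dist (F \<omega>') (F \<omega>) \<le> e / 2"
        using tendsto_upperbound V(2) unfolding ultra_def by blast
      with e show ?thesis by simp
    qed
    with W show "\<exists>W. openin (hull_of \<mu>) W \<and> \<omega> \<in> W \<and> (\<forall>\<omega>'\<in>W. dist (F \<omega>') (F \<omega>) < e)"
      by blast
  qed
qed

text \<open>The hypothesis concerns coordinate functions only. A limit map \<open>p\<close> of the
  hull into itself carries continuity over from the coordinates to all \<open>f\<close>, in place of
  an approximation by polynomials in the coordinates.\<close>

lemma wap_dynamical_system_hull:
  assumes wap: "\<And>c. c \<in> Cc \<Longrightarrow> wap_function (conv c \<mu>)"
  shows "wap_dynamical_system (hull_of \<mu>) translate_measure"
  unfolding wap_dynamical_system_def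
proof (intro conjI dynamical_system_hull ballI)
  fix f assume "f \<in> C_space (hull_of \<mu>)"
  then have f: "continuous_map (hull_of \<mu>) euclidean f" by (simp add: C_space_def)
  obtain M where M: "\<And>\<nu>. \<nu> \<in> topspace (hull_of \<mu>) \<Longrightarrow> cmod (f \<nu>) \<le> M"
    using compact_space_bounded[OF compact_hull f] by blast
  let ?A = "range (\<lambda>t. \<lambda>\<nu>\<in>topspace (hull_of \<mu>). f (translate_measure t \<nu>))"
  show "relatively_compact_in (weak_topology (topspace (hull_of \<mu>)) (C_space (hull_of \<mu>))) ?A"
  proof (rule grothendieck_relatively_compact)
    have "continuous_map (hull_of \<mu>) euclidean (\<lambda>\<nu>. f (translate_measure t \<nu>))" for t
      using continuous_map_compose[OF continuous_translate f] by (simp add: o_def)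
    then show "?A \<subseteq> C_space (hull_of \<mu>)"
      by (auto simp: C_space_def intro: continuous_map_eq)
    show "topspace (hull_of \<mu>) \<noteq> {}" using orbit_in_hull by auto
    show "\<forall>g\<in>?A. \<forall>\<nu>\<in>topspace (hull_of \<mu>). cmod (g \<nu>) \<le> M"
      using M translate_hull by simp
    fix F assume "pointwise_limit (topspace (hull_of \<mu>)) ?A F"
    then obtain U where U: "ultra U"
      and F: "\<And>\<nu>. \<nu> \<in> hull_set \<Longrightarrow> ((\<lambda>t. (\<lambda>\<nu>\<in>hull_set. f (translate_measure t \<nu>)) \<nu>) \<longlongrightarrow> F \<nu>) U"
      by (rule pointwise_limit_range_ultra) auto
    \<comment> \<open>The ultrafilter that yields \<open>F\<close> also yields, by compactness of
      the hull, a pointwise limit \<open>p\<close> of the translations; \<open>F\<close> then equals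
      \<open>f \<circ> p\<close> on the hull.\<close>
    have "\<forall>\<nu>\<in>hull_set. \<exists>l. limitin (hull_of \<mu>) (\<lambda>t. translate_measure t \<nu>) l U"
    proof
      fix \<nu> assume "\<nu> \<in> hull_set"
      then have "eventually (\<lambda>t. translate_measure t \<nu> \<in> topspace (hull_of \<mu>)) U"
        by (simp add: translate_hull)
      then show "\<exists>l. limitin (hull_of \<mu>) (\<lambda>t. translate_measure t \<nu>) l U"
        using ultra_limitin_compactin[OF U] compact_hull unfolding compact_space_def by metis
    qed
    from bchoice[OF this] obtain p
      where p: "\<And>\<nu>. \<nu> \<in> hull_set \<Longrightarrow> limitin (hull_of \<mu>) (\<lambda>t. translate_measure t \<nu>) (p \<nu>) U" by blast
    have "continuous_map (hull_of \<mu>) (hull_of \<mu>) p"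
    proof (rule continuous_map_into_hull)
      show "p \<nu> \<in> hull_set" if "\<nu> \<in> topspace (hull_of \<mu>)" for \<nu>
        using limitin_topspace[OF p] that by simp
    next
      fix c :: "'a \<Rightarrow> complex" assume c: "c \<in> Cc"
      define k where "k = (\<lambda>\<nu>\<in>hull_set. \<nu> c)"
      have k: "continuous_map (hull_of \<mu>) euclidean k"
        by (rule continuous_map_eq[OF continuous_map_hull_coordinate[OF c]]) (simp add: k_def)
      \<comment> \<open>\<open>orbit_fun_coordinate\<close> reflects its argument, so the coordinate
        at \<open>c\<close> corresponds to convolution with the reflected function, again in
        \<open>Cc\<close>.\<close>
      have "orbit_fun k = conv (\<lambda>s. c (- s)) \<mu>"
        using orbit_fun_coordinate[OF Cc_reflect[OF c]] by (simp add: k_def)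
      then have "relatively_compact_in (weak_topology UNIV Cu) (range (\<lambda>t. translate_fun t (orbit_fun k)))"
        using wap[OF Cc_reflect[OF c]] by (simp add: wap_function_def)
      moreover have "((\<lambda>t. k (translate_measure t \<nu>)) \<longlongrightarrow> p \<nu> c) U" if \<nu>: "\<nu> \<in> hull_set" for \<nu>
        using continuous_map_limit[OF k p[OF \<nu>]] limitin_topspace[OF p[OF \<nu>]]
        by (simp add: o_def k_def)
      ultimately show "continuous_map (hull_of \<mu>) euclidean (\<lambda>\<nu>. p \<nu> c)"
        by (rule continuous_ultra_limit[OF k _ U])
    qed
    then have fp: "continuous_map (hull_of \<mu>) euclidean (f \<circ> p)"
      using f by (rule continuous_map_compose)
    have "F \<nu> = (f \<circ> p) \<nu>" if \<nu>: "\<nu> \<in> hull_set" for \<nu>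
    proof (rule tendsto_unique)
      show "U \<noteq> bot" using U by (simp add: ultra_def)
      show "((\<lambda>t. f (translate_measure t \<nu>)) \<longlongrightarrow> F \<nu>) U"
        using F[OF \<nu>] \<nu> by simp
      show "((\<lambda>t. f (translate_measure t \<nu>)) \<longlongrightarrow> (f \<circ> p) \<nu>) U"
        using continuous_map_limit[OF f p[OF \<nu>]] by (simp add: o_def)
    qed
    then show "continuous_map (hull_of \<mu>) euclidean F"
      using fp by (auto intro: continuous_map_eq)
  qed (rule compact_hull)
qed

end

theorem theorem3p6:
  fixes \<mu> :: "('a::{topological_ab_group_add, t2_space} \<Rightarrow> complex) \<Rightarrow> complex"
  assumes "locally_compact_space (euclidean :: 'a topology)"
    and "\<mu> \<in> translation_bounded_measures"
  shows "wap_measure \<mu> \<longleftrightarrow> wap_dynamical_system (hull_of \<mu>) translate_measure"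
proof -
  obtain C where "range (\<lambda>t. translate_measure t \<mu>) \<subseteq> equibounded C"
    using translation_bounded_equibounded[OF assms(2)] .
  then interpret translation_bounded \<mu> C
    using assms by unfold_locales (auto simp: translation_bounded_measures_def radon_measures_def)
  show ?thesis
    using assms(2) wap_function_conv wap_dynamical_system_hull by (auto simp: wap_measure_def)
qed

end
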